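(* For any $d\in\mathbb N$, $\beta>0$, $a>0$ and $\alpha\le 0$, the sequence of probability measures $\big(\nu^{\mathrm{CMF}}_{N,\alpha}\big)_{N\ge 1}$ satisfies a large deviation principle on $\ell_1(\mathbb R_+)$ with rate (speed) $\beta|\Lambda_N|$ and rate function $$I^{\mathrm{CMF}}_\alpha(x)=H^{\mathrm{CMF}}(x)+I_\alpha(x)-\inf_{y\in\ell_1(\mathbb R_+)}\{H^{\mathrm{CMF}}(y)+I_\alpha(y)\}.$$
   Context: $|\Lambda_N|=(2N)^d$ for $N\in\mathbb N=\{1,2,\dots\}$. For $\alpha\le 0$ and $k\in\mathbb N$ put $$q_k^{(\alpha)}=\frac{e^{\beta k\alpha}}{(4\pi\beta)^{d/2}k^{1+d/2}},\qquad \bar q^{(\alpha)}=\sum_{k\in\mathbb N}q_k^{(\alpha)}.$$ $\ell_1(\mathbb R_+)$ is the space of nonnegative summable real sequences with the $\ell_1$-norm topology. Let $(\mathcal N_k)_{k\in\mathbb N}$ be independent Poisson random variables, $\mathcal N_k$ with parameter $|\Lambda_N|q_k^{(\alpha)}$; $\nu_{N,\alpha}$ denotes the law on $\ell_1(\mathbb R_+)$ of $(\mathcal N_k/|\Lambda_N|)_{k\in\mathbb N}$. Define $$I_\alpha(x)=\sum_{k=1}^\infty\frac{x_k}{\beta}\Big(\log\frac{x_k}{q_k^{(\alpha)}}-1\Big)+\frac{\bar q^{(\alpha)}}{\beta}\in[0,\infty],\qquad x\in\ell_1(\mathbb R_+)\quad(0\log 0=0),$$ $$H^{\mathrm{CMF}}(x)=\frac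 a2\Big(\sum_{k=1}^\infty x_k\Big)^2,\qquad \nu^{\mathrm{CMF}}_{N,\alpha}(\mathrm dx)=\frac{e^{-\beta|\Lambda_N|H^{\mathrm{CMF}}(x)}}{Z_N^{\mathrm{CMF}}(\beta,\alpha)}\nu_{N,\alpha}(\mathrm dx),$$ where $Z_N^{\mathrm{CMF}}(\beta,\alpha)=\mathbb E_{\nu_{N,\alpha}}[e^{-\beta|\Lambda_N|H^{\mathrm{CMF}}}]$. A large deviation principle with rate (speed) $r_N\to\infty$ and rate function $I$ for measures $P_N$ on $X$ means: $I:X\to[0,\infty]$ is lower semicontinuous, $\liminf_N r_N^{-1}\log P_N(G)\ge-\inf_G I$ for open $G$ and $\limsup_N r_N^{-1}\log P_N(F)\le-\inf_F I$ for closed $F$. *)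

theory Defs
  imports "HOL-Probability.Probability"
begin

section \<open>The space of nonnegative summable sequences\<close>

text \<open>Sequences are indexed from 0: \<open>coord x k\<close> is the coordinate $x_{k+1}$ of a sequence
  indexed by the positive integers.\<close>

typedef l1_nonneg = "{x :: nat \<Rightarrow> real. (\<forall>k. 0 \<le> x k) \<and> summable x}"
  morphisms coord Abs_l1_nonneg
  by (rule exI[of _ "\<lambda>_. 0"]) auto

lemma coord_nonneg: "0 \<le> coord x k"
  using coord[of x] by auto

lemma summable_coord: "summable (coord x)"
  using coord[of x] by auto

lemma summable_coord_diff: "summable (\<lambda>k. \<bar>coord x k - coord y k\<bar>)"
proof (rule summable_comparison_test'[where N = 0])
  show "summable (\<lambda>k. coord x k + coord y k)"
    by (intro summable_add summable_coord)
  show "norm \<bar>coord x k - coord y k\<bar> \<le> coord x k + coord y k" for k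
    using coord_nonneg[of x k] coord_nonneg[of y k] by auto
qed

instantiation l1_nonneg :: metric_space
begin

definition dist_l1_nonneg :: "l1_nonneg \<Rightarrow> l1_nonneg \<Rightarrow> real" where
  "dist_l1_nonneg x y = (\<Sum>k. \<bar>coord x k - coord y k\<bar>)"

definition uniformity_l1_nonneg :: "(l1_nonneg \<times> l1_nonneg) filter" where
  "uniformity_l1_nonneg = (INF e\<in>{0 <..}. principal {(x, y). dist x y < e})"

definition open_l1_nonneg :: "l1_nonneg set \<Rightarrow> bool" where
  "open_l1_nonneg U = (\<forall>x\<in>U. \<forall>\<^sub>F (x', y) in uniformity. x' = x \<longrightarrow> y \<in> U)"

instance
proof
  fix x y z :: l1_nonneg
  show "dist x y = 0 \<longleftrightarrow> x = y"
    unfolding dist_l1_nonneg_def using suminf_eq_zero_iff[OF summable_coord_diff[of x y]]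
    by (auto simp: coord_inject[symmetric] fun_eq_iff)
  have "dist x y \<le> (\<Sum>k. \<bar>coord x k - coord z k\<bar> + \<bar>coord y k - coord z k\<bar>)"
    unfolding dist_l1_nonneg_def
    by (intro suminf_le summable_add summable_coord_diff) auto
  also have "\<dots> = dist x z + dist y z"
    unfolding dist_l1_nonneg_def
    by (intro suminf_add[symmetric] summable_coord_diff)
  finally show "dist x y \<le> dist x z + dist y z" .
qed (simp_all add: uniformity_l1_nonneg_def open_l1_nonneg_def)

end


section \<open>Large deviation principles\<close>

definition ext_log :: "real \<Rightarrow> ereal" where
  "ext_log p = (if p = 0 then - \<infinity> else ereal (ln p))"

definition large_deviation_principle ::
    "(nat \<Rightarrow> 'a::topological_space measure) \<Rightarrow> (nat \<Rightarrow> real) \<Rightarrow> ('a \<Rightarrow> ereal) \<Rightarrow> bool" where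
  "large_deviation_principle P r I \<longleftrightarrow>
     filterlim r at_top sequentially \<and>
     (\<forall>x. 0 \<le> I x) \<and>
     (\<forall>c. closed {x. I x \<le> c}) \<and>
     (\<forall>G. open G \<longrightarrow>
        - (INF x\<in>G. I x) \<le> liminf (\<lambda>N. ext_log (measure (P N) G) / ereal (r N))) \<and>
     (\<forall>F. closed F \<longrightarrow>
        limsup (\<lambda>N. ext_log (measure (P N) F) / ereal (r N)) \<le> - (INF x\<in>F. I x))"


section \<open>The cycle-mean-field model\<close>

text \<open>\<open>q_weight d \<beta> \<alpha> k\<close> is $q_k^{(\alpha)}$ with the original index $k \ge 1$; it is always used
  at \<open>Suc k\<close>, matching \<open>coord x k\<close>.\<close>

definition q_weight :: "nat \<Rightarrow> real \<Rightarrow> real \<Rightarrow> nat \<Rightarrow> real" where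
  "q_weight d \<beta> \<alpha> k =
     exp (\<beta> * real k * \<alpha>) / ((4 * pi * \<beta>) powr (real d / 2) * real k powr (1 + real d / 2))"

definition qbar :: "nat \<Rightarrow> real \<Rightarrow> real \<Rightarrow> real" where
  "qbar d \<beta> \<alpha> = (\<Sum>k. q_weight d \<beta> \<alpha> (Suc k))"

definition vol :: "nat \<Rightarrow> nat \<Rightarrow> real" where
  "vol d N = (2 * real N) ^ d"

text \<open>\<open>poisson_pmf\<close> is specified for positive rates only, so the following is meaningful for
  \<open>N \<ge> 1\<close>; the value at \<open>N = 0\<close> does not affect a large deviation principle.\<close>

definition cycle_counts :: "nat \<Rightarrow> real \<Rightarrow> real \<Rightarrow> nat \<Rightarrow> (nat \<Rightarrow> nat) measure" where
  "cycle_counts d \<beta> \<alpha> N =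
     PiM UNIV (\<lambda>k. measure_pmf (poisson_pmf (vol d N * q_weight d \<beta> \<alpha> (Suc k))))"

text \<open>The counts are summable only almost surely (see \<open>AE_summable_cycle_counts\<close> below); on the
  null set where they are not, the value is set to the zero sequence.\<close>

definition rescaled_counts :: "nat \<Rightarrow> nat \<Rightarrow> (nat \<Rightarrow> nat) \<Rightarrow> l1_nonneg" where
  "rescaled_counts d N n =
     (if summable (\<lambda>k. real (n k) / vol d N) then Abs_l1_nonneg (\<lambda>k. real (n k) / vol d N)
      else Abs_l1_nonneg (\<lambda>_. 0))"

definition nu :: "nat \<Rightarrow> real \<Rightarrow> real \<Rightarrow> nat \<Rightarrow> l1_nonneg measure" where
  "nu d \<beta> \<alpha> N = distr (cycle_counts d \<beta> \<alpha> N) borel (rescaled_counts d N)"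

definition H_CMF :: "real \<Rightarrow> l1_nonneg \<Rightarrow> real" where
  "H_CMF a x = a / 2 * (\<Sum>k. coord x k)\<^sup>2"

definition Z_CMF :: "nat \<Rightarrow> real \<Rightarrow> real \<Rightarrow> real \<Rightarrow> nat \<Rightarrow> real" where
  "Z_CMF d \<beta> a \<alpha> N = (LINT x|nu d \<beta> \<alpha> N. exp (- \<beta> * vol d N * H_CMF a x))"

definition nu_CMF :: "nat \<Rightarrow> real \<Rightarrow> real \<Rightarrow> real \<Rightarrow> nat \<Rightarrow> l1_nonneg measure" where
  "nu_CMF d \<beta> a \<alpha> N =
     density (nu d \<beta> \<alpha> N)
       (\<lambda>x. ennreal (exp (- \<beta> * vol d N * H_CMF a x) / Z_CMF d \<beta> a \<alpha> N))"

text \<open>The series is taken in the extended reals, where it always converges, possibly to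
  \<open>\<infinity>\<close> (see \<open>summable_I_free\<close> below).  The convention $0 \log 0 = 0$ holds since the factor
  \<open>coord x k\<close> vanishes.\<close>

definition I_free :: "nat \<Rightarrow> real \<Rightarrow> real \<Rightarrow> l1_nonneg \<Rightarrow> ereal" where
  "I_free d \<beta> \<alpha> x =
     (\<Sum>k. ereal (coord x k / \<beta> * (ln (coord x k / q_weight d \<beta> \<alpha> (Suc k)) - 1)))
     + ereal (qbar d \<beta> \<alpha> / \<beta>)"

definition I_CMF :: "nat \<Rightarrow> real \<Rightarrow> real \<Rightarrow> real \<Rightarrow> l1_nonneg \<Rightarrow> ereal" where
  "I_CMF d \<beta> a \<alpha> x =
     ereal (H_CMF a x) + I_free d \<beta> \<alpha> x - (INF y. ereal (H_CMF a y) + I_free d \<beta> \<alpha> y)"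


section \<open>Well-definedness\<close>

lemma q_weight_pos: "0 < \<beta> \<Longrightarrow> 0 < q_weight d \<beta> \<alpha> (Suc k)"
  by (simp add: q_weight_def)

lemma vol_pos: "1 \<le> N \<Longrightarrow> 0 < vol d N"
  by (simp add: vol_def)

lemma summable_q_weight:
  assumes "1 \<le> d" "0 < \<beta>" "\<alpha> \<le> 0"
  shows "summable (\<lambda>k. q_weight d \<beta> \<alpha> (Suc k))"
proof -
  define C where "C = (4 * pi * \<beta>) powr (real d / 2)"
  have C: "C > 0" using assms by (simp add: C_def)
  have "summable (\<lambda>k. real k powr (- (1 + real d / 2)))"
    using assms by (subst summable_real_powr_iff) auto
  hence "summable (\<lambda>k. real (Suc k) powr (- (1 + real d / 2)))"
    by (subst summable_Suc_iff)
  hence s: "summable (\<lambda>k. 1 / C * real (Suc k) powr (- (1 + real d / 2)))"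
    by (rule summable_mult)
  show ?thesis
  proof (rule summable_comparison_test'[OF s])
    fix k :: nat
    have "exp (\<beta> * real (Suc k) * \<alpha>) \<le> 1"
      using assms by (simp add: mult_nonneg_nonpos)
    hence "q_weight d \<beta> \<alpha> (Suc k) \<le> 1 / (C * real (Suc k) powr (1 + real d / 2))"
      unfolding q_weight_def C_def[symmetric] using C by (intro divide_right_mono) auto
    also have "\<dots> = 1 / C * real (Suc k) powr (- (1 + real d / 2))"
      by (simp only: powr_minus_divide) simp
    finally show "norm (q_weight d \<beta> \<alpha> (Suc k)) \<le> 1 / C * real (Suc k) powr (- (1 + real d / 2))"
      using q_weight_pos[OF assms(2), of d \<alpha> k] by simp
  qed
qed

lemma product_prob_space_cycle_counts:
  "product_prob_space (\<lambda>k. measure_pmf (poisson_pmf (vol d N * q_weight d \<beta> \<alpha> (Suc k))))"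
  by (rule product_prob_spaceI) (rule measure_pmf.prob_space_axioms)

lemma prob_space_cycle_counts: "prob_space (cycle_counts d \<beta> \<alpha> N)"
  unfolding cycle_counts_def
  by (intro prob_space_PiM measure_pmf.prob_space_axioms)

lemma measurable_component_cycle_counts:
  "(\<lambda>n. n k) \<in> cycle_counts d \<beta> \<alpha> N \<rightarrow>\<^sub>M count_space UNIV"
  unfolding cycle_counts_def
  using measurable_component_singleton[of k UNIV
    "\<lambda>k. measure_pmf (poisson_pmf (vol d N * q_weight d \<beta> \<alpha> (Suc k)))"] by simp

lemma AE_summable_cycle_counts:
  assumes "1 \<le> d" "0 < \<beta>" "\<alpha> \<le> 0" "1 \<le> N"
  shows "AE n in cycle_counts d \<beta> \<alpha> N. summable (\<lambda>k. real (n k) / vol d N)"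
proof -
  interpret prob_space "cycle_counts d \<beta> \<alpha> N" by (rule prob_space_cycle_counts)
  note [measurable] = measurable_component_cycle_counts[of _ d \<beta> \<alpha> N]
  let ?M = "cycle_counts d \<beta> \<alpha> N"
  define A where "A k = {n \<in> space ?M. n k \<noteq> 0}" for k
  have A[measurable]: "A k \<in> sets ?M" for k unfolding A_def by measurable
  have le: "prob (A k) \<le> vol d N * q_weight d \<beta> \<alpha> (Suc k)" for k
  proof -
    let ?r = "vol d N * q_weight d \<beta> \<alpha> (Suc k)"
    have r: "0 < ?r" using assms by (simp add: vol_pos q_weight_pos)
    interpret P: product_prob_space "\<lambda>k. measure_pmf (poisson_pmf (vol d N * q_weight d \<beta> \<alpha> (Suc k)))" UNIV
      by (rule product_prob_space_cycle_counts)
    have "prob (A k) = measure (distr ?M (measure_pmf (poisson_pmf ?r)) (\<lambda>n. n k)) {m. m \<noteq> 0}"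
      by (subst measure_distr) (auto simp: A_def intro!: arg_cong[of _ _ prob])
    also have "distr ?M (measure_pmf (poisson_pmf ?r)) (\<lambda>n. n k) = measure_pmf (poisson_pmf ?r)"
      unfolding cycle_counts_def by (rule P.PiM_component) simp
    also have "measure (measure_pmf (poisson_pmf ?r)) {m. m \<noteq> 0} = 1 - exp (- ?r)"
    proof -
      have "{m::nat. m \<noteq> 0} = UNIV - {0}" by auto
      thus ?thesis
        using measure_pmf.prob_compl[of "{0}" "poisson_pmf ?r"] r
        by (simp add: measure_pmf_single)
    qed
    also have "\<dots> \<le> ?r" using exp_ge_add_one_self[of "- ?r"] by simp
    finally show ?thesis .
  qed
  have "summable (\<lambda>k. prob (A k))"
  proof (rule summable_comparison_test')
    show "summable (\<lambda>k. vol d N * q_weight d \<beta> \<alpha> (Suc k))"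
      by (intro summable_mult summable_q_weight assms)
    show "norm (prob (A k)) \<le> vol d N * q_weight d \<beta> \<alpha> (Suc k)" if "k \<ge> 0" for k
      using le[of k] by simp
  qed
  hence "AE n in ?M. eventually (\<lambda>k. n \<in> space ?M - A k) sequentially"
    by (intro borel_cantelli_AE1) (auto simp: less_top[symmetric])
  thus ?thesis
  proof eventually_elim
    case (elim n)
    then obtain K where "\<And>k. k \<ge> K \<Longrightarrow> n k = 0"
      unfolding eventually_sequentially A_def by auto
    thus ?case
      by (intro summable_finite[of "{..<K}"]) auto
  qed
qed

lemma measurable_rescaled_counts:
  "rescaled_counts d N \<in> cycle_counts d \<beta> \<alpha> N \<rightarrow>\<^sub>M borel"
proof -
  let ?M = "cycle_counts d \<beta> \<alpha> N"
  note [measurable] = measurable_component_cycle_counts[of _ d \<beta> \<alpha> N]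
  define S where "S = {n \<in> space ?M. summable (\<lambda>k. real (n k) / vol d N)}"
  define T where "T m n =
     Abs_l1_nonneg (\<lambda>k. if k < m then real (n k) / vol d N else 0)" for m :: nat and n
  have v: "0 \<le> vol d N" by (simp add: vol_def)
  have coord_T: "coord (T m n) = (\<lambda>k. if k < m then real (n k) / vol d N else 0)" for m n
    unfolding T_def using v
    by (intro Abs_l1_nonneg_inverse) (auto intro!: summable_finite[of "{..<m}"])
  have S: "S \<in> sets ?M"
  proof -
    have [measurable]: "(\<lambda>n. \<Sum>k<m. real (n k) / vol d N) \<in> borel_measurable ?M" for m
      by measurable
    have "S = {n \<in> space ?M. Cauchy (\<lambda>m. \<Sum>k<m. real (n k) / vol d N)}"
      unfolding S_def summable_iff_convergent Cauchy_convergent_iff ..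
    also have "\<dots> \<in> sets ?M" by (rule sets_Collect_Cauchy) measurable
    finally show ?thesis .
  qed
  have T: "T m \<in> ?M \<rightarrow>\<^sub>M borel" for m
  proof -
    have l: "(\<lambda>n. map n [0..<m]) \<in> ?M \<rightarrow>\<^sub>M count_space UNIV"
    proof (rule measurable_count_space_eq2_countable[THEN iffD2], intro conjI ballI)
      fix l :: "nat list"
      have map_l: "map n [0..<m] = l \<longleftrightarrow> length l = m \<and> (\<forall>k\<in>{..<m}. n k = l ! k)" for n
        unfolding list_eq_iff_nth_eq by (cases "length l = m") (simp_all add: Ball_def)
      have eq: "(\<lambda>n. map n [0..<m]) -` {l} \<inter> space ?M =
          (if length l = m then {n \<in> space ?M. \<forall>k\<in>{..<m}. n k = l ! k} else {})"
        unfolding vimage_def Int_def mem_Collect_eq singleton_iff map_l by auto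
      have "{n \<in> space ?M. n k = l ! k} \<in> sets ?M" for k
        using measurable_sets[OF measurable_component_cycle_counts, of "{l ! k}" k d \<beta> \<alpha> N]
        by (simp add: vimage_def Int_def conj_commute)
      hence "{n \<in> space ?M. \<forall>k\<in>{..<m}. n k = l ! k} \<in> sets ?M"
        by (intro sets.sets_Collect_finite_All) auto
      thus "(\<lambda>n. map n [0..<m]) -` {l} \<inter> space ?M \<in> sets ?M"
        unfolding eq by (cases "length l = m") (simp_all only: if_True if_False sets.empty_sets refl)
    qed (rule funcsetI, rule UNIV_I)
    have "T m = (\<lambda>l. T m (\<lambda>k. l ! k)) \<circ> (\<lambda>n. map n [0..<m])"
    proof
      fix n
      have "(\<lambda>k. if k < m then real (n k) / vol d N else 0) =
          (\<lambda>k. if k < m then real (map n [0..<m] ! k) / vol d N else 0)"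
        by (rule ext) simp
      thus "T m n = ((\<lambda>l. T m (\<lambda>k. l ! k)) \<circ> (\<lambda>n. map n [0..<m])) n"
        by (simp only: T_def o_apply)
    qed
    thus ?thesis using measurable_comp[OF l, of "\<lambda>l. T m (\<lambda>k. l ! k)" borel] by simp
  qed
  have "(\<lambda>n. if n \<in> S then T m n else Abs_l1_nonneg (\<lambda>_. 0)) \<in> ?M \<rightarrow>\<^sub>M borel" for m
    by (rule measurable_If_set[OF T]) (use S in \<open>auto simp: sets.Int_space_eq2\<close>)
  moreover have "(\<lambda>m. if n \<in> S then T m n else Abs_l1_nonneg (\<lambda>_. 0))
      \<longlonglongrightarrow> rescaled_counts d N n" if n: "n \<in> space ?M" for n
  proof (cases "n \<in> S")
    case True
    hence s: "summable (\<lambda>k. real (n k) / vol d N)" by (simp add: S_def)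
    have c: "coord (rescaled_counts d N n) = (\<lambda>k. real (n k) / vol d N)"
      unfolding rescaled_counts_def using s v by (simp add: Abs_l1_nonneg_inverse)
    have "dist (T m n) (rescaled_counts d N n) = (\<Sum>k. real (n (k + m)) / vol d N)" for m
    proof -
      let ?f = "\<lambda>k. \<bar>coord (T m n) k - coord (rescaled_counts d N n) k\<bar>"
      have "dist (T m n) (rescaled_counts d N n) = (\<Sum>k. ?f (k + m)) + sum ?f {..<m}"
        unfolding dist_l1_nonneg_def by (rule suminf_split_initial_segment[OF summable_coord_diff])
      also have "sum ?f {..<m} = 0" by (simp add: coord_T c)
      finally show ?thesis using v by (simp add: coord_T c)
    qed
    moreover have "(\<lambda>m. \<Sum>k. real (n (k + m)) / vol d N) \<longlonglongrightarrow> 0"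
      using suminf_exist_split2[OF s] by simp
    ultimately show ?thesis using True
      by (subst tendsto_dist_iff) simp
  next
    case False
    thus ?thesis using n by (simp add: S_def rescaled_counts_def)
  qed
  ultimately show ?thesis by (rule borel_measurable_LIMSEQ_metric)
qed

lemma sets_nu [measurable_cong, simp]: "sets (nu d \<beta> \<alpha> N) = sets borel"
  by (simp add: nu_def)

lemma space_nu [simp]: "space (nu d \<beta> \<alpha> N) = UNIV"
  by (simp add: nu_def)

lemma prob_space_nu: "prob_space (nu d \<beta> \<alpha> N)"
  unfolding nu_def
  by (intro prob_space.prob_space_distr prob_space_cycle_counts measurable_rescaled_counts)

lemma measurable_H_CMF [measurable]: "H_CMF a \<in> borel_measurable borel"
proof -
  have "continuous_on UNIV (\<lambda>x. \<Sum>k. coord x k)"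
  proof (rule continuous_on_iff[THEN iffD2], intro ballI allI impI)
    fix x :: l1_nonneg and e :: real assume "0 < e"
    have "dist (\<Sum>k. coord y k) (\<Sum>k. coord x k) \<le> dist y x" for y
    proof -
      have "dist (\<Sum>k. coord y k) (\<Sum>k. coord x k) = \<bar>\<Sum>k. coord y k - coord x k\<bar>"
        by (simp add: dist_real_def suminf_diff[OF summable_coord summable_coord])
      also have "\<dots> \<le> dist y x"
        unfolding dist_l1_nonneg_def by (rule summable_rabs[OF summable_coord_diff])
      finally show ?thesis .
    qed
    thus "\<exists>\<delta>>0. \<forall>y\<in>UNIV. dist y x < \<delta> \<longrightarrow> dist (\<Sum>k. coord y k) (\<Sum>k. coord x k) < e"
      using \<open>0 < e\<close> by (meson le_less_trans)
  qed
  hence "(\<lambda>x. \<Sum>k. coord x k) \<in> borel_measurable borel"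
    by (rule borel_measurable_continuous_onI)
  thus ?thesis unfolding H_CMF_def[abs_def] by measurable
qed

lemma prob_space_nu_CMF:
  assumes "0 < \<beta>" "0 < a"
  shows "prob_space (nu_CMF d \<beta> a \<alpha> N)"
proof -
  interpret prob_space "nu d \<beta> \<alpha> N" by (rule prob_space_nu)
  let ?f = "\<lambda>x. exp (- \<beta> * vol d N * H_CMF a x)"
  have "0 \<le> vol d N" by (simp add: vol_def)
  hence b: "?f x \<le> 1" for x
    using assms by (simp add: H_CMF_def)
  have int: "integrable (nu d \<beta> \<alpha> N) ?f"
    by (rule integrable_const_bound[where B = 1]) (use b in auto)
  have Z: "0 < Z_CMF d \<beta> a \<alpha> N"
    unfolding Z_CMF_def using int
    by (rule expectation_greater) simp
  have "(\<integral>\<^sup>+x. ennreal (?f x / Z_CMF d \<beta> a \<alpha> N) \<partial>nu d \<beta> \<alpha> N) =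
      ennreal (\<integral>x. ?f x / Z_CMF d \<beta> a \<alpha> N \<partial>nu d \<beta> \<alpha> N)"
    using int Z by (intro nn_integral_eq_integral) auto
  also have "(\<integral>x. ?f x / Z_CMF d \<beta> a \<alpha> N \<partial>nu d \<beta> \<alpha> N) = 1"
    using Z by (simp add: Z_CMF_def)
  finally have eq: "(\<integral>\<^sup>+x. ennreal (?f x / Z_CMF d \<beta> a \<alpha> N) \<partial>nu d \<beta> \<alpha> N) = 1"
    by simp
  have "emeasure (nu_CMF d \<beta> a \<alpha> N) (space (nu d \<beta> \<alpha> N)) =
      (\<integral>\<^sup>+x. ennreal (?f x / Z_CMF d \<beta> a \<alpha> N) * indicator (space (nu d \<beta> \<alpha> N)) x \<partial>nu d \<beta> \<alpha> N)"
    unfolding nu_CMF_def by (rule emeasure_density) auto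
  also have "\<dots> = (\<integral>\<^sup>+x. ennreal (?f x / Z_CMF d \<beta> a \<alpha> N) \<partial>nu d \<beta> \<alpha> N)"
    by (rule nn_integral_cong) simp
  finally show ?thesis
    using eq by (intro prob_spaceI) (simp add: nu_CMF_def)
qed

lemma summable_I_free:
  assumes "1 \<le> d" "0 < \<beta>" "\<alpha> \<le> 0"
  shows "summable (\<lambda>k. ereal (coord x k / \<beta> * (ln (coord x k / q_weight d \<beta> \<alpha> (Suc k)) - 1)))"
proof -
  define p where "p k = q_weight d \<beta> \<alpha> (Suc k) / \<beta>" for k
  define f where "f k = coord x k / \<beta> * (ln (coord x k / q_weight d \<beta> \<alpha> (Suc k)) - 1)" for k
  have nonneg: "0 \<le> f k + p k" for k
  proof (cases "coord x k = 0")
    case True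
    thus ?thesis using q_weight_pos[OF assms(2)] assms(2) by (simp add: f_def p_def less_imp_le)
  next
    case False
    define y where "y = coord x k"
    define r where "r = q_weight d \<beta> \<alpha> (Suc k)"
    have y: "0 < y" using False coord_nonneg[of x k] by (simp add: y_def)
    have r: "0 < r" using q_weight_pos[OF assms(2)] by (simp add: r_def)
    have "ln (r / y) \<le> r / y - 1" using y r by (intro ln_le_minus_one) simp
    hence "y * (ln (y / r) - 1) + r \<ge> 0"
      using y r by (simp add: ln_div field_simps)
    hence "(y * (ln (y / r) - 1) + r) / \<beta> \<ge> 0" using assms(2) by simp
    thus ?thesis by (simp add: f_def p_def y_def r_def add_divide_distrib)
  qed
  have "(\<lambda>k. ereal (f k + p k)) sums (\<Sum>k. ereal (f k + p k))"
    by (intro summable_sums summable_ereal_pos) (use nonneg in simp)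
  moreover have "(\<lambda>k. - p k) sums (- (\<Sum>k. p k))"
    unfolding p_def by (intro sums_minus summable_sums summable_divide summable_q_weight assms)
  hence "(\<lambda>m. ereal (\<Sum>k<m. - p k)) \<longlonglongrightarrow> ereal (- (\<Sum>k. p k))"
    by (simp add: sums_def)
  ultimately have "(\<lambda>m. (\<Sum>k<m. ereal (f k + p k)) + ereal (\<Sum>k<m. - p k))
      \<longlonglongrightarrow> (\<Sum>k. ereal (f k + p k)) + ereal (- (\<Sum>k. p k))"
    by (intro tendsto_add_ereal_general1) (simp_all add: sums_def)
  also have "(\<lambda>m. (\<Sum>k<m. ereal (f k + p k)) + ereal (\<Sum>k<m. - p k)) = (\<lambda>m. \<Sum>k<m. ereal (f k))"
    by (simp add: sum_ereal sum.distrib sum_negf)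
  finally show ?thesis unfolding f_def[symmetric] by (auto simp: summable_def sums_def)
qed

end

theory Submission
  imports Defs "HOL-Real_Asymp.Real_Asymp"
begin

text \<open>
  The counts are independent Poisson variables, and both the free rate function and the interaction
  are explicit, so the principle can be proved by direct estimates on point probabilities, without
  an abstract contraction, projective limit or tilting theorem.

  Multiplied by \<open>\<beta>\<close>, the free rate function is the sum over \<open>k\<close> of the Cramer costs
  \<open>poisson_cost\<close> of the single Poisson variables.  The cost is an upper bound for the exponential
  decay of Poisson masses at every volume (\<open>pmf_poisson_le\<close>) and is attained in the limit
  (\<open>tendsto_log_poisson_minorant\<close>).  Consider the weighted measure \<open>weight N\<close>, the
  law of the rescaled counts multiplied by the Boltzmann factor of \<open>H_CMF\<close> but not normalised.

  Lower bound: near any \<open>x\<close> in an open set there is a single integer configuration, obtained by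
  cutting \<open>x\<close> off at a large index \<open>K\<close> and rounding down, whose weight already has the required
  exponential order; forcing all counts beyond \<open>K\<close> to vanish costs only the tail sum \<open>q_tail K\<close>
  (\<open>measure_weight_ge\<close>).

  Upper bound: by Chernoff's inequality the mass beyond a large index and the total mass are
  controlled at any prescribed exponential rate (\<open>emeasure_exceedance_le\<close>).  On the remaining
  event the first \<open>K\<close> counts take only polynomially many values, and each value contributes at most
  the exponential of minus the energy of a truncated sequence close to the given closed set
  (\<open>measure_weight_le\<close>).  The interaction needs no continuity argument here, because truncation
  lowers it.  The level sets of the energy are compact (bounded cost forces uniformly small tails),
  so the infimum over a small neighbourhood of a closed set is close to the infimum over the set
  itself (\<open>energy_on_neighbourhood\<close>).

  Both bounds for the whole space identify the decay rate of the partition function, and dividing by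
  it subtracts the infimum from the rate function (\<open>large_deviation_principle_normalize\<close>).
\<close>

section \<open>Exponential estimates for Poisson probabilities\<close>

text \<open>The Cramer rate function of the Poisson law with mean \<open>q\<close>, for \<open>x \<ge> 0\<close>: the value at
  \<open>x = 0\<close> is \<open>q\<close> thanks to the factor \<open>x\<close>.\<close>

definition poisson_cost :: "real \<Rightarrow> real \<Rightarrow> real" where
  "poisson_cost q x = x * (ln (x / q) - 1) + q"

lemma poisson_cost_0 [simp]: "poisson_cost q 0 = q"
  by (simp add: poisson_cost_def)

text \<open>The easy half of Legendre duality: the cost lies above each affine function given by the
  logarithmic moment generating function \<open>q * (exp l - 1)\<close>.  Taking \<open>l\<close> large turns a bound on the
  total cost into uniform smallness of tails; \<open>l = 0\<close> gives nonnegativity.\<close>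

lemma poisson_cost_ge_affine:
  assumes "0 < q" "0 \<le> x"
  shows "l * x - q * (exp l - 1) \<le> poisson_cost q x"
proof (cases "x = 0")
  case True
  then show ?thesis using assms by (simp add: algebra_simps)
next
  case False
  then have x: "0 < x" using assms by simp
  have "ln (q * exp l / x) \<le> q * exp l / x - 1"
    using assms x by (intro ln_le_minus_one) simp
  then have "x * (ln q + l - ln x) \<le> x * (q * exp l / x - 1)"
    using assms x by (intro mult_left_mono) (simp_all add: ln_div ln_mult)
  also have "\<dots> = q * exp l - x" using x by (simp add: field_simps)
  finally show ?thesis
    using assms x by (simp add: poisson_cost_def ln_div algebra_simps)
qed

lemma poisson_cost_nonneg: "0 < q \<Longrightarrow> 0 \<le> x \<Longrightarrow> 0 \<le> poisson_cost q x"
  using poisson_cost_ge_affine[of q x 0] by simp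

lemma continuous_on_poisson_cost:
  assumes "0 < q"
  shows "continuous_on {0..} (poisson_cost q)"
  unfolding continuous_on_eq_continuous_within
proof
  fix x :: real assume "x \<in> {0..}"
  then consider "x = 0" | "0 < x" by fastforce
  then show "continuous (at x within {0..}) (poisson_cost q)"
  proof cases
    case 1
    have "((\<lambda>x::real. x * (ln (x / q) - 1) + q) \<longlongrightarrow> q) (at_right 0)"
      using assms by real_asymp
    then show ?thesis
      using 1 by (simp add: continuous_within at_within_Ici_at_right poisson_cost_def[abs_def])
  next
    case 2
    then show ?thesis using assms unfolding poisson_cost_def
      by (auto intro!: continuous_intros)
  qed
qed

text \<open>A non-asymptotic upper bound on point probabilities.  The Poisson law with mean \<open>V * q\<close> is an
  exponential tilt of the one with mean \<open>n\<close>; the tilting factor at \<open>n\<close> is exactly the right-hand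
  side, and the mass of \<open>n\<close> under the tilted law is at most 1.\<close>

lemma pmf_poisson_le:
  assumes "0 < V" "0 < q"
  shows "pmf (poisson_pmf (V * q)) n \<le> exp (- V * poisson_cost q (real n / V))"
proof (cases "n = 0")
  case True
  then show ?thesis using assms by simp
next
  case False
  then have n: "0 < real n" by simp
  have "pmf (poisson_pmf (real n)) n \<le> 1" by (rule pmf_le_1)
  then have le: "real n ^ n / fact n * exp (- real n) \<le> 1" using n by simp
  have "(V * q) ^ n = real n ^ n * (V * q / real n) ^ n"
    using n by (simp flip: power_mult_distrib)
  also have "V * q / real n = exp (- ln (real n / V / q))"
    using n assms by (simp add: exp_minus)
  also have "\<dots> ^ n = exp (- real n * ln (real n / V / q))"
    by (simp flip: exp_of_nat_mult)
  finally have "pmf (poisson_pmf (V * q)) n =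
      (real n ^ n / fact n * exp (- real n)) *
      (exp (real n) * (exp (- real n * ln (real n / V / q)) * exp (- V * q)))"
    using assms by (simp add: exp_minus field_simps)
  also have "\<dots> \<le> 1 * (exp (real n) * (exp (- real n * ln (real n / V / q)) * exp (- V * q)))"
    using le by (rule mult_right_mono) simp
  also have "\<dots> = exp (- V * poisson_cost q (real n / V))"
    using assms by (simp add: poisson_cost_def algebra_simps flip: exp_add)
  finally show ?thesis .
qed

text \<open>The leading order of Stirling's formula suffices below, since only the exponential rate of the
  point probabilities matters.\<close>

lemma ln_fact_le: "ln (fact n) \<le> (real n + 1) * ln (real n + 1) - real n"
proof (induction n)
  case (Suc n)
  let ?m = "real n + 1"
  have "ln (?m / (?m + 1)) \<le> ?m / (?m + 1) - 1" by (intro ln_le_minus_one) simp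
  then have "1 / (?m + 1) \<le> ln (?m + 1) - ln ?m" by (simp add: ln_div field_simps)
  then have "1 \<le> (?m + 1) * (ln (?m + 1) - ln ?m)" by (simp add: field_simps)
  then have s: "?m * ln ?m + ln ?m \<le> (?m + 1) * ln (?m + 1) - 1"
    by (simp add: algebra_simps)
  have "ln (fact (Suc n)) = ln ?m + ln (fact n)"
    by (simp add: ln_mult add.commute)
  with Suc.IH s show ?case by (simp add: add_ac)
qed simp

text \<open>A lower bound for the logarithm of the Poisson mass at \<open>nat \<lfloor>V * x\<rfloor>\<close> in which the rounding of
  \<open>V * x\<close> has been absorbed, so that it is an elementary function of the real variable \<open>V\<close> whose
  growth rate can be read off.\<close>

definition log_poisson_minorant :: "real \<Rightarrow> real \<Rightarrow> real \<Rightarrow> real" where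
  "log_poisson_minorant q x V = - V * q + V * x * ln q - \<bar>ln q\<bar> + (V * x - 1) * ln V
     - ((V * x + 1) * ln (V * x + 1) - V * x + 1)"

lemma log_poisson_minorant_le:
  assumes "1 \<le> V" "0 < q" "0 \<le> x"
  shows "exp (log_poisson_minorant q x V) \<le> pmf (poisson_pmf (V * q)) (nat \<lfloor>V * x\<rfloor>)"
proof -
  define n where "n = nat \<lfloor>V * x\<rfloor>"
  have n: "real n \<le> V * x" "V * x - 1 \<le> real n"
    unfolding n_def using assms by (simp_all add: of_nat_floor)
  have "\<bar>(real n - V * x) * ln q\<bar> \<le> 1 * \<bar>ln q\<bar>"
    unfolding abs_mult using n by (intro mult_right_mono) auto
  then have 1: "V * x * ln q - \<bar>ln q\<bar> \<le> real n * ln q" by (simp add: algebra_simps abs_le_iff)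
  have 2: "(V * x - 1) * ln V \<le> real n * ln V"
    using assms n by (intro mult_right_mono) auto
  have "(real n + 1) * ln (real n + 1) \<le> (V * x + 1) * ln (V * x + 1)"
    using n by (intro mult_mono) auto
  with ln_fact_le[of n] n have 3: "ln (fact n) \<le> (V * x + 1) * ln (V * x + 1) - V * x + 1"
    by linarith
  have "log_poisson_minorant q x V \<le> - V * q + real n * (ln q + ln V) - ln (fact n)"
    using 1 2 3 unfolding log_poisson_minorant_def distrib_left by linarith
  also have "\<dots> = ln (pmf (poisson_pmf (V * q)) n)"
    using assms by (simp add: ln_mult ln_div ln_realpow algebra_simps)
  finally have "exp (log_poisson_minorant q x V) \<le> exp (ln (pmf (poisson_pmf (V * q)) n))"
    by simp
  also have "\<dots> = pmf (poisson_pmf (V * q)) n" using assms by (subst exp_ln) simp_all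
  finally show ?thesis by (simp add: n_def)
qed

text \<open>Together with the upper bound on point probabilities this shows that the cost is the exact
  exponential rate of the Poisson masses.\<close>

lemma tendsto_log_poisson_minorant:
  assumes "0 < q" "0 \<le> x"
  shows "((\<lambda>V. log_poisson_minorant q x V / V) \<longlongrightarrow> - poisson_cost q x) at_top"
proof -
  define L where "L = ln q"
  define A where "A = \<bar>ln q\<bar>"
  show ?thesis
  proof (cases "x = 0")
    case True
    have "((\<lambda>V. (- V * q - A - ln V - 1) / V) \<longlongrightarrow> - q) at_top"
      by real_asymp
    then show ?thesis using True
      by (simp add: log_poisson_minorant_def A_def)
  next
    case False
    then have x: "0 < x" using assms by simp
    have "((\<lambda>V. (- V * q + V * x * L - A + (V * x - 1) * ln V
        - ((V * x + 1) * ln (V * x + 1) - V * x + 1)) / V)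
      \<longlongrightarrow> - q + x * L - x * ln x + x) at_top"
      using x assms by real_asymp
    then show ?thesis using x assms
      by (simp add: log_poisson_minorant_def poisson_cost_def L_def A_def algebra_simps ln_div)
  qed
qed

lemma nn_integral_exp_poisson:
  assumes "0 < r"
  shows "(\<integral>\<^sup>+ n. ennreal (exp (l * real n)) \<partial>poisson_pmf r) = ennreal (exp (r * (exp l - 1)))"
proof -
  have s: "(\<lambda>n. exp (- r) * ((r * exp l) ^ n /\<^sub>R fact n)) sums (exp (- r) * exp (r * exp l))"
    by (intro sums_mult exp_converges)
  have "(\<integral>\<^sup>+ n. ennreal (exp (l * real n)) \<partial>poisson_pmf r) =
      (\<integral>\<^sup>+ n. ennreal (exp (- r) * ((r * exp l) ^ n /\<^sub>R fact n)) \<partial>count_space UNIV)"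
    using assms unfolding nn_integral_measure_pmf
    by (intro nn_integral_cong)
      (simp add: exp_of_nat2_mult power_mult_distrib divide_simps flip: ennreal_mult)
  also have "\<dots> = ennreal (exp (- r) * exp (r * exp l))"
    unfolding nn_integral_count_space_nat using s assms
    by (intro suminf_ennreal_eq) simp_all
  finally show ?thesis by (simp add: algebra_simps flip: exp_add)
qed

section \<open>Convergence and compactness of nonnegative summable sequences\<close>

lemma total_diff_le_dist: "\<bar>(\<Sum>k. coord x k) - (\<Sum>k. coord y k)\<bar> \<le> dist x y"
proof -
  have "\<bar>(\<Sum>k. coord x k) - (\<Sum>k. coord y k)\<bar> = \<bar>\<Sum>k. coord x k - coord y k\<bar>"
    by (simp add: suminf_diff[OF summable_coord summable_coord])
  also have "\<dots> \<le> dist x y"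
    unfolding dist_l1_nonneg_def by (rule summable_rabs[OF summable_coord_diff])
  finally show ?thesis .
qed

lemma coord_diff_le_dist: "\<bar>coord x k - coord y k\<bar> \<le> dist x y"
  using sum_le_suminf[OF summable_coord_diff[of x y], of "{k}"]
  by (simp add: dist_l1_nonneg_def)

lemma continuous_on_coord: "continuous_on A (\<lambda>x. coord x k)"
  unfolding continuous_on_iff dist_real_def
  using coord_diff_le_dist by (meson le_less_trans)

lemma continuous_on_total: "continuous_on A (\<lambda>x. \<Sum>k. coord x k)"
  unfolding continuous_on_iff dist_real_def
  using total_diff_le_dist by (meson le_less_trans)

lemma continuous_on_H_CMF: "continuous_on A (H_CMF a)"
  unfolding H_CMF_def[abs_def] by (intro continuous_intros continuous_on_total)

lemma summable_coord_shift: "summable (\<lambda>k. coord x (k + K))"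
  using summable_coord by (subst summable_iff_shift)

lemma dist_le_head_tails:
  "dist x y \<le> (\<Sum>k<K. \<bar>coord x k - coord y k\<bar>)
     + (\<Sum>k. coord x (k + K)) + (\<Sum>k. coord y (k + K))"
proof -
  have "(\<Sum>k. \<bar>coord x (k + K) - coord y (k + K)\<bar>) \<le> (\<Sum>k. coord x (k + K) + coord y (k + K))"
    using summable_coord_diff[of x y]
    by (intro suminf_le summable_add summable_coord_shift)
      (auto simp: summable_iff_shift[of "\<lambda>k. \<bar>coord x k - coord y k\<bar>"] abs_le_iff
          intro: add_increasing add_increasing2 coord_nonneg)
  also have "\<dots> = (\<Sum>k. coord x (k + K)) + (\<Sum>k. coord y (k + K))"
    by (intro suminf_add[symmetric] summable_coord_shift)
  finally show ?thesis
    unfolding dist_l1_nonneg_def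
    using suminf_split_initial_segment[OF summable_coord_diff, of x y K] by simp
qed

text \<open>Relative compactness in the summable sequences: the box of coordinates is compact for pointwise
  convergence, and uniformly small tails upgrade pointwise convergence to convergence in norm.\<close>

lemma convergent_subsequence_of_small_tails:
  fixes X :: "nat \<Rightarrow> l1_nonneg"
  assumes bound: "\<And>n. (\<Sum>k. coord (X n) k) \<le> C"
    and tails: "\<And>e. 0 < e \<Longrightarrow> \<exists>K. \<forall>n. (\<Sum>k. coord (X n) (k + K)) \<le> e"
  obtains x r where "strict_mono r" "(X \<circ> r) \<longlonglongrightarrow> x"
proof -
  have "coord (X n) k \<le> C" for n k
    using sum_le_suminf[OF summable_coord[of "X n"], of "{k}"] bound[of n]
    by (simp add: coord_nonneg)
  then have in_box: "coord (X n) \<in> PiE UNIV (\<lambda>_. {0..C})" for n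
    by (auto simp: coord_nonneg)
  have "compact (PiE (UNIV :: nat set) (\<lambda>_. {0..C}))"
    using compactin_PiE[of "\<lambda>_. euclidean" "UNIV :: nat set" "\<lambda>_. {0..C}"]
    by (simp add: euclidean_product_topology)
  then have "seq_compact (PiE (UNIV :: nat set) (\<lambda>_. {0..C}))"
    by (rule compact_imp_seq_compact)
  then obtain y r where y: "y \<in> PiE UNIV (\<lambda>_. {0..C})" and r: "strict_mono (r :: nat \<Rightarrow> nat)"
    and lim: "((\<lambda>n. coord (X n)) \<circ> r) \<longlonglongrightarrow> y"
    using in_box unfolding seq_compact_def by (metis (no_types, lifting) o_def)
  have y_nonneg: "0 \<le> y k" for k using y by auto
  have coord_lim: "(\<lambda>n. coord (X (r n)) k) \<longlonglongrightarrow> y k" for k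
    using continuous_on_tendsto_compose[OF continuous_on_product_coordinates[of k] lim]
    by (simp add: o_def)
  \<comment> \<open>Bounds on partial sums of tails survive the coordinatewise limit.\<close>
  have partial: "(\<Sum>k<L. y (k + K)) \<le> e" if "\<forall>n. (\<Sum>k. coord (X n) (k + K)) \<le> e" for K L e
  proof (rule LIMSEQ_le_const2)
    show "(\<lambda>n. \<Sum>k<L. coord (X (r n)) (k + K)) \<longlonglongrightarrow> (\<Sum>k<L. y (k + K))"
      by (intro tendsto_sum coord_lim)
    have "(\<Sum>k<L. coord (X (r n)) (k + K)) \<le> e" for n
      using sum_le_suminf[OF summable_coord_shift[of "X (r n)" K], of "{..<L}"] that
      by (meson coord_nonneg finite_lessThan order_trans)
    then show "\<exists>N. \<forall>n\<ge>N. (\<Sum>k<L. coord (X (r n)) (k + K)) \<le> e" by blast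
  qed
  have "summable y"
    using partial[where K = 0 and e = C] bound y_nonneg
    by (intro bounded_imp_summable[where B = C])
      (auto simp: lessThan_Suc_atMost[symmetric] simp del: sum.lessThan_Suc)
  then have x: "coord (Abs_l1_nonneg y) = y"
    using y_nonneg by (intro Abs_l1_nonneg_inverse) simp
  have "(X \<circ> r) \<longlonglongrightarrow> Abs_l1_nonneg y"
  proof (rule metric_LIMSEQ_I)
    fix e :: real assume e: "0 < e"
    then obtain K where K: "\<forall>n. (\<Sum>k. coord (X n) (k + K)) \<le> e / 4"
      using tails[of "e / 4"] by auto
    have ytail: "(\<Sum>k. y (k + K)) \<le> e / 4"
      using partial[OF K] \<open>summable y\<close> by (intro suminf_le_const) (simp_all add: summable_iff_shift)
    have "(\<lambda>n. \<Sum>k<K. \<bar>coord (X (r n)) k - y k\<bar>) \<longlonglongrightarrow> (\<Sum>k<K. \<bar>y k - y k\<bar>)"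
      by (intro tendsto_intros coord_lim)
    then have "eventually (\<lambda>n. (\<Sum>k<K. \<bar>coord (X (r n)) k - y k\<bar>) < e / 4) sequentially"
      by (rule order_tendstoD(2)) (use e in simp)
    then obtain N where N: "\<And>n. N \<le> n \<Longrightarrow> (\<Sum>k<K. \<bar>coord (X (r n)) k - y k\<bar>) < e / 4"
      by (auto simp: eventually_sequentially)
    have "dist ((X \<circ> r) n) (Abs_l1_nonneg y) < e" if "N \<le> n" for n
      using dist_le_head_tails[of "X (r n)" "Abs_l1_nonneg y" K] N[OF that] K[THEN spec, of "r n"]
        ytail e by (simp add: x)
    then show "\<exists>N. \<forall>n\<ge>N. dist ((X \<circ> r) n) (Abs_l1_nonneg y) < e" by blast
  qed
  with r that show thesis by blast
qed

text \<open>Truncation sets the coordinates from \<open>K\<close> on to zero.  Truncated sequences take the place of a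
  general configuration in both bounds, because only finitely many coordinates can be counted.\<close>

definition truncate :: "nat \<Rightarrow> l1_nonneg \<Rightarrow> l1_nonneg" where
  "truncate K x = Abs_l1_nonneg (\<lambda>k. if k < K then coord x k else 0)"

lemma coord_truncate: "coord (truncate K x) k = (if k < K then coord x k else 0)"
proof -
  have "coord (truncate K x) = (\<lambda>k. if k < K then coord x k else 0)"
    unfolding truncate_def
    by (intro Abs_l1_nonneg_inverse) (auto intro!: summable_finite[of "{..<K}"] coord_nonneg)
  then show ?thesis by simp
qed

lemma total_truncate: "(\<Sum>k. coord (truncate K x) k) = (\<Sum>k<K. coord x k)"
  by (subst suminf_finite[of "{..<K}"]) (simp_all add: coord_truncate)

lemma dist_truncate_le: "dist x (truncate K x) \<le> (\<Sum>k. coord x (k + K))"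
  using dist_le_head_tails[of x "truncate K x" K] by (simp add: coord_truncate)

section \<open>The unnormalised rate function\<close>

locale cycle_mean_field =
  fixes d :: nat and \<beta> a \<alpha> :: real
  assumes d_pos: "1 \<le> d" and beta_pos: "0 < \<beta>" and a_pos: "0 < a" and alpha_nonpos: "\<alpha> \<le> 0"
begin

abbreviation q :: "nat \<Rightarrow> real" where
  "q k \<equiv> q_weight d \<beta> \<alpha> (Suc k)"

abbreviation q_tail :: "nat \<Rightarrow> real" where
  "q_tail K \<equiv> \<Sum>k. q (k + K)"

text \<open>The unnormalised rate function \<open>energy\<close> is the supremum of the functionals \<open>energy_upto K\<close>,
  each of which sees only finitely many costs and is continuous.\<close>

definition energy_upto :: "nat \<Rightarrow> l1_nonneg \<Rightarrow> real" where
  "energy_upto K x = H_CMF a x + (\<Sum>k<K. poisson_cost (q k) (coord x k)) / \<beta>"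

definition energy :: "l1_nonneg \<Rightarrow> ereal" where
  "energy x = ereal (H_CMF a x) + I_free d \<beta> \<alpha> x"

lemma q_pos: "0 < q k"
  using beta_pos by (rule q_weight_pos)

lemma summable_q: "summable q"
  using d_pos beta_pos alpha_nonpos by (rule summable_q_weight)

lemma summable_q_shift: "summable (\<lambda>k. q (k + K))"
  using summable_q by (subst summable_iff_shift)

lemma q_tail_nonneg: "0 \<le> q_tail K"
  by (intro suminf_nonneg summable_q_shift less_imp_le[OF q_pos])

lemma tendsto_q_tail: "q_tail \<longlonglongrightarrow> 0"
  using suminf_exist_split2[OF summable_q] .

lemma sum_q_le_q_tail: "(\<Sum>k\<in>{K..<L}. q k) \<le> q_tail K"
proof (cases "K \<le> L")
  case True
  have "(\<Sum>k\<in>{K..<L}. q k) = (\<Sum>k<L - K. q (k + K))"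
    using True sum.shift_bounds_nat_ivl[of q 0 K "L - K"] by (simp add: atLeast0LessThan)
  also have "\<dots> \<le> q_tail K"
    by (intro sum_le_suminf summable_q_shift) (auto intro: less_imp_le[OF q_pos])
  finally show ?thesis .
qed (simp add: q_tail_nonneg)

lemma cost_nonneg: "0 \<le> poisson_cost (q k) (coord x k)"
  using q_pos coord_nonneg by (rule poisson_cost_nonneg)

lemma H_CMF_nonneg: "0 \<le> H_CMF a x"
  using a_pos by (simp add: H_CMF_def)

lemma energy_upto_nonneg: "0 \<le> energy_upto K x"
  unfolding energy_upto_def using beta_pos H_CMF_nonneg
  by (simp add: sum_nonneg cost_nonneg)

lemma energy_upto_mono: "K \<le> L \<Longrightarrow> energy_upto K x \<le> energy_upto L x"
  unfolding energy_upto_def using beta_pos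
  by (intro add_left_mono divide_right_mono sum_mono2) (auto simp: cost_nonneg)

text \<open>Adding \<open>q k / \<beta>\<close> to the \<open>k\<close>-th term of the series in \<open>I_free\<close> makes all terms nonnegative,
  and these additions sum to the constant \<open>qbar / \<beta>\<close>; the partial sums are then increasing, so the
  limit is a supremum.\<close>

lemma energy_eq_SUP: "energy x = (SUP K. ereal (energy_upto K x))"
proof -
  define f where "f k = coord x k / \<beta> * (ln (coord x k / q k) - 1)" for k
  have "summable (\<lambda>k. ereal (f k))"
    unfolding f_def using d_pos beta_pos alpha_nonpos by (rule summable_I_free)
  then have "(\<lambda>K. \<Sum>k<K. ereal (f k)) \<longlonglongrightarrow> (\<Sum>k. ereal (f k))"
    using summable_LIMSEQ by blast
  moreover have "(\<lambda>K. ereal (H_CMF a x + (\<Sum>k<K. q k) / \<beta>)) \<longlonglongrightarrow> ereal (H_CMF a x + (\<Sum>k. q k) / \<beta>)"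
    unfolding lim_ereal using beta_pos
    by (intro tendsto_intros summable_LIMSEQ summable_q) auto
  ultimately have "(\<lambda>K. (\<Sum>k<K. ereal (f k)) + ereal (H_CMF a x + (\<Sum>k<K. q k) / \<beta>))
      \<longlonglongrightarrow> (\<Sum>k. ereal (f k)) + ereal (H_CMF a x + (\<Sum>k. q k) / \<beta>)"
    by (intro tendsto_add_ereal_general1) simp_all
  also have "(\<lambda>K. (\<Sum>k<K. ereal (f k)) + ereal (H_CMF a x + (\<Sum>k<K. q k) / \<beta>)) =
      (\<lambda>K. ereal (energy_upto K x))"
    using beta_pos
    by (auto simp: energy_upto_def poisson_cost_def f_def sum_ereal sum.distrib sum_divide_distrib
        add_divide_distrib)
  also have "(\<Sum>k. ereal (f k)) + ereal (H_CMF a x + (\<Sum>k. q k) / \<beta>) = energy x"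
    unfolding energy_def I_free_def f_def[symmetric] qbar_def
    by (cases "\<Sum>k. ereal (f k)") simp_all
  finally have "(\<lambda>K. ereal (energy_upto K x)) \<longlonglongrightarrow> energy x" .
  moreover have "(\<lambda>K. ereal (energy_upto K x)) \<longlonglongrightarrow> (SUP K. ereal (energy_upto K x))"
    by (intro LIMSEQ_SUP incseq_SucI) (simp add: energy_upto_mono)
  ultimately show ?thesis by (rule LIMSEQ_unique)
qed

lemma energy_upto_le_energy: "ereal (energy_upto K x) \<le> energy x"
  unfolding energy_eq_SUP by (rule SUP_upper) simp

lemma energy_nonneg: "0 \<le> energy x"
  using energy_upto_le_energy[of 0 x] energy_upto_nonneg[of 0 x]
  by (meson ereal_less_eq(5) order_trans)

lemma energy_zero: "energy (Abs_l1_nonneg (\<lambda>_. 0)) = ereal (q_tail 0 / \<beta>)"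
  by (simp add: energy_def H_CMF_def I_free_def qbar_def Abs_l1_nonneg_inverse flip: zero_ereal_def)

lemma INF_energy_finite: "\<bar>INF x. energy x\<bar> \<noteq> \<infinity>"
proof -
  have "(INF x. energy x) \<le> ereal (q_tail 0 / \<beta>)"
    unfolding energy_zero[symmetric] by (rule INF_lower) simp
  moreover have "0 \<le> (INF x. energy x)"
    by (intro INF_greatest energy_nonneg)
  ultimately show ?thesis by auto
qed

text \<open>Lower semicontinuity: a supremum of continuous functions.\<close>

lemma closed_energy_le: "closed {x. energy x \<le> c}"
proof -
  have "continuous_on UNIV (\<lambda>x. poisson_cost (q k) (coord x k))" for k
    by (rule continuous_on_compose2[OF continuous_on_poisson_cost[OF q_pos] continuous_on_coord])
      (auto simp: coord_nonneg)
  then have "continuous_on UNIV (\<lambda>x. ereal (energy_upto K x))" for K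
    unfolding energy_upto_def[abs_def] using beta_pos
    by (intro continuous_on_ereal continuous_on_add continuous_on_divide continuous_on_sum
        continuous_on_const continuous_on_H_CMF) auto
  then have "closed {x. ereal (energy_upto K x) \<le> c}" for K
    by (intro closed_Collect_le continuous_on_const)
  moreover have "{x. energy x \<le> c} = (\<Inter>K. {x. ereal (energy_upto K x) \<le> c})"
    by (auto simp: energy_eq_SUP SUP_le_iff)
  ultimately show ?thesis by auto
qed

text \<open>Legendre duality summed over the coordinates from \<open>K\<close> on.  Choosing first \<open>l\<close> large and then
  \<open>K\<close> large makes the bound as small as desired, uniformly over an energy level set.\<close>

lemma tail_mass_le_of_energy_le:
  assumes "energy x \<le> ereal c" "0 < l"
  shows "(\<Sum>k. coord x (k + K)) \<le> (\<beta> * c + q_tail K * exp l) / l"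
proof (rule suminf_le_const[OF summable_coord_shift])
  fix L
  have "energy_upto (K + L) x \<le> c"
    using energy_upto_le_energy[of "K + L" x] assms(1) by (meson ereal_less_eq(3) order_trans)
  then have "(\<Sum>k<K + L. poisson_cost (q k) (coord x k)) / \<beta> \<le> c"
    using H_CMF_nonneg[of x] by (simp add: energy_upto_def)
  then have le: "(\<Sum>k<K + L. poisson_cost (q k) (coord x k)) \<le> \<beta> * c"
    using beta_pos by (simp add: field_simps)
  have "(\<Sum>k<L. l * coord x (k + K) - q (k + K) * (exp l - 1)) \<le>
      (\<Sum>k<L. poisson_cost (q (k + K)) (coord x (k + K)))"
    by (intro sum_mono poisson_cost_ge_affine q_pos coord_nonneg)
  also have "\<dots> = (\<Sum>k\<in>{K..<K + L}. poisson_cost (q k) (coord x k))"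
    using sum.shift_bounds_nat_ivl[of "\<lambda>k. poisson_cost (q k) (coord x k)" 0 K L]
    by (simp add: atLeast0LessThan add.commute)
  also have "\<dots> \<le> (\<Sum>k<K + L. poisson_cost (q k) (coord x k))"
    by (intro sum_mono2) (auto simp: cost_nonneg)
  also note le
  finally have "l * (\<Sum>k<L. coord x (k + K)) \<le> \<beta> * c + (\<Sum>k<L. q (k + K)) * (exp l - 1)"
    by (simp add: sum_subtractf sum_distrib_left sum_distrib_right)
  also have "(\<Sum>k<L. q (k + K)) * (exp l - 1) \<le> q_tail K * exp l"
    using assms(2)
    by (intro mult_mono sum_le_suminf summable_q_shift q_tail_nonneg)
      (auto intro: less_imp_le[OF q_pos])
  finally show "(\<Sum>k<L. coord x (k + K)) \<le> (\<beta> * c + q_tail K * exp l) / l"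
    using assms(2) by (simp add: field_simps)
qed

lemma convergent_subsequence_of_energy_le:
  fixes X :: "nat \<Rightarrow> l1_nonneg"
  assumes X: "\<And>n. energy (X n) \<le> ereal c"
  obtains x r where "strict_mono r" "(X \<circ> r) \<longlonglongrightarrow> x"
proof (rule convergent_subsequence_of_small_tails)
  show "(\<Sum>k. coord (X n) k) \<le> (\<beta> * c + q_tail 0 * exp 1) / 1" for n
    using tail_mass_le_of_energy_le[OF X, of 1 n 0] by simp
  fix e :: real assume e: "0 < e"
  \<comment> \<open>\<open>l\<close> and \<open>K\<close> make the numerator of the tail bound at most \<open>l * e\<close>\<close>
  define l where "l = (\<bar>\<beta> * c\<bar> + 1) / e"
  have l: "0 < l" using e by (simp add: l_def)
  have "eventually (\<lambda>K. q_tail K < exp (- l)) sequentially"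
    by (rule order_tendstoD(2)[OF tendsto_q_tail]) simp
  then obtain K where "q_tail K < exp (- l)"
    using eventually_happens'[OF sequentially_bot] by blast
  then have "q_tail K * exp l \<le> 1" by (simp add: exp_minus field_simps)
  then have "(\<beta> * c + q_tail K * exp l) / l \<le> (\<bar>\<beta> * c\<bar> + 1) / l"
    using l by (intro divide_right_mono) auto
  also have "\<dots> = e" using e by (simp add: l_def)
  finally have "(\<Sum>k. coord (X n) (k + K)) \<le> e" for n
    using tail_mass_le_of_energy_le[OF X l, of n K] by linarith
  then show "\<exists>K. \<forall>n. (\<Sum>k. coord (X n) (k + K)) \<le> e" by blast
qed (rule that)

text \<open>Compactness of the level sets allows a closed set to be enlarged slightly without essentially
  lowering the infimum of the energy.  This absorbs the truncation error in the upper bound.\<close>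

lemma energy_on_neighbourhood:
  assumes F: "closed F" and c: "ereal c < (INF x\<in>F. energy x)"
  obtains e where "0 < e" "\<And>x y. x \<in> F \<Longrightarrow> dist x y \<le> e \<Longrightarrow> ereal c < energy y"
proof (rule ccontr)
  assume "\<not> thesis"
  then have "\<exists>x y. x \<in> F \<and> dist x y \<le> 1 / real (Suc n) \<and> energy y \<le> ereal c" for n
    using that[of "1 / real (Suc n)"] by (metis not_le of_nat_0_less_iff zero_less_Suc zero_less_divide_1_iff)
  then obtain X Y where XY: "\<And>n. X n \<in> F" "\<And>n. dist (X n) (Y n) \<le> 1 / real (Suc n)"
      "\<And>n. energy (Y n) \<le> ereal c"
    by metis
  obtain y r where r: "strict_mono r" and y: "(Y \<circ> r) \<longlonglongrightarrow> y"
    using convergent_subsequence_of_energy_le[of Y, OF XY(3)] .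
  have "(\<lambda>n. dist (X n) (Y n)) \<longlonglongrightarrow> 0"
    by (rule tendsto_sandwich[OF _ _ tendsto_const LIMSEQ_Suc[OF lim_1_over_n]])
      (use XY(2) in auto)
  then have "(\<lambda>n. dist (X (r n)) (Y (r n))) \<longlonglongrightarrow> 0"
    using LIMSEQ_subseq_LIMSEQ[OF _ r] by (fastforce simp: o_def)
  moreover have "(\<lambda>n. dist (Y (r n)) y) \<longlonglongrightarrow> 0"
    using y by (simp add: o_def tendsto_dist_iff[of _ y])
  ultimately have "(\<lambda>n. dist (X (r n)) (Y (r n)) + dist (Y (r n)) y) \<longlonglongrightarrow> 0"
    by (rule tendsto_add_zero)
  then have "(\<lambda>n. dist ((X \<circ> r) n) y) \<longlonglongrightarrow> 0"
    by (rule tendsto_sandwich[OF _ _ tendsto_const, rotated 2]) (simp_all add: dist_triangle)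
  then have "(X \<circ> r) \<longlonglongrightarrow> y"
    by (simp add: tendsto_dist_iff[of _ y])
  then have "y \<in> F"
    using closed_sequentially[OF F, of "X \<circ> r" y] XY(1) by simp
  moreover have "y \<in> {x. energy x \<le> ereal c}"
    using closed_sequentially[OF closed_energy_le, of "Y \<circ> r" _ y] y XY(3) by simp
  ultimately show False using c INF_lower[of y F energy] by auto
qed

end

section \<open>The law of the cycle counts\<close>

lemma coord_rescaled_counts:
  assumes "summable (\<lambda>k. real (n k) / vol d N)"
  shows "coord (rescaled_counts d N n) k = real (n k) / vol d N"
  using assms by (simp add: rescaled_counts_def Abs_l1_nonneg_inverse vol_def)

lemma space_cycle_counts: "space (cycle_counts d \<beta> \<alpha> N) = UNIV"
  by (simp add: cycle_counts_def space_PiM)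

text \<open>Independence in the form used for Chernoff's bound: expectations of products over finite windows
  factorise.\<close>

lemma nn_integral_prod_cycle_counts:
  assumes "finite J"
  shows "(\<integral>\<^sup>+n. (\<Prod>k\<in>J. f k (n k)) \<partial>cycle_counts d \<beta> \<alpha> N) =
    (\<Prod>k\<in>J. \<integral>\<^sup>+i. f k i \<partial>poisson_pmf (vol d N * q_weight d \<beta> \<alpha> (Suc k)))"
proof -
  let ?P = "\<lambda>k. measure_pmf (poisson_pmf (vol d N * q_weight d \<beta> \<alpha> (Suc k)))"
  interpret P: product_prob_space ?P UNIV
    by (rule product_prob_space_cycle_counts)
  have "(\<integral>\<^sup>+n. (\<Prod>k\<in>J. f k (n k)) \<partial>cycle_counts d \<beta> \<alpha> N) =
      (\<integral>\<^sup>+n. (\<Prod>k\<in>J. f k (restrict n J k)) \<partial>PiM UNIV ?P)"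
    unfolding cycle_counts_def by simp
  also have "\<dots> = (\<integral>\<^sup>+n. (\<Prod>k\<in>J. f k (n k)) \<partial>distr (PiM UNIV ?P) (PiM J ?P) (\<lambda>n. restrict n J))"
  proof (rule nn_integral_distr[symmetric])
    show "(\<lambda>n. restrict n J) \<in> PiM UNIV ?P \<rightarrow>\<^sub>M PiM J ?P"
      by (rule measurable_restrict_subset) simp
    have "(\<lambda>n. f k (n k)) \<in> borel_measurable (PiM J ?P)" if "k \<in> J" for k
      using measurable_comp[OF measurable_component_singleton[OF that, of ?P], of "f k" borel]
      by (simp add: o_def)
    then have "(\<lambda>n. \<Prod>k\<in>J. f k (n k)) \<in> borel_measurable (PiM J ?P)"
      by (rule borel_measurable_prod_ennreal)
    then show "(\<lambda>n. \<Prod>k\<in>J. f k (n k))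
        \<in> borel_measurable (distr (PiM UNIV ?P) (PiM J ?P) (\<lambda>n. restrict n J))"
      by simp
  qed
  also have "distr (PiM UNIV ?P) (PiM J ?P) (\<lambda>n. restrict n J) = PiM J ?P"
    using assms by (intro P.distr_PiM_restrict_finite) simp_all
  also have "(\<integral>\<^sup>+n. (\<Prod>k\<in>J. f k (n k)) \<partial>PiM J ?P) = (\<Prod>k\<in>J. \<integral>\<^sup>+i. f k i \<partial>?P k)"
    using assms by (intro P.product_nn_integral_prod) simp_all
  finally show ?thesis .
qed

lemma cylinder_sets [measurable]:
  "finite J \<Longrightarrow> {n. \<forall>k\<in>J. n k = m k} \<in> sets (cycle_counts d \<beta> \<alpha> N)"
proof -
  note [measurable] = measurable_component_cycle_counts[of _ d \<beta> \<alpha> N]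
  assume "finite J"
  moreover have "{n \<in> space (cycle_counts d \<beta> \<alpha> N). n k = m k} \<in> sets (cycle_counts d \<beta> \<alpha> N)" for k
    by measurable
  ultimately have "{n \<in> space (cycle_counts d \<beta> \<alpha> N). \<forall>k\<in>J. n k = m k} \<in> sets (cycle_counts d \<beta> \<alpha> N)"
    by (intro sets.sets_Collect_finite_All) auto
  then show ?thesis by (simp add: space_cycle_counts)
qed

lemma emeasure_cylinder_cycle_counts:
  assumes "finite J"
  shows "emeasure (cycle_counts d \<beta> \<alpha> N) {n. \<forall>k\<in>J. n k = m k} =
    ennreal (\<Prod>k\<in>J. pmf (poisson_pmf (vol d N * q_weight d \<beta> \<alpha> (Suc k))) (m k))"
proof -
  let ?P = "\<lambda>k. measure_pmf (poisson_pmf (vol d N * q_weight d \<beta> \<alpha> (Suc k)))"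
  interpret P: product_prob_space ?P UNIV
    by (rule product_prob_space_cycle_counts)
  show ?thesis
    using P.emeasure_PiM_Collect[of J "\<lambda>k. {m k}"] assms
    by (simp add: cycle_counts_def space_PiM emeasure_pmf_single prod_ennreal)
qed

context cycle_mean_field
begin

text \<open>The event that the rescaled counts from index \<open>K\<close> on have mass above \<open>e\<close>.  Stated through
  finite windows, it also contains the configurations of infinite mass, which
  \<open>rescaled_counts\<close> sends to zero; off the event no almost-sure qualification is needed.\<close>

definition exceedance :: "nat \<Rightarrow> nat \<Rightarrow> real \<Rightarrow> (nat \<Rightarrow> nat) set" where
  "exceedance N K e = {n. \<exists>L. vol d N * e < (\<Sum>k\<in>{K..<L}. real (n k))}"

lemma exceedance_eq_Union:
  "exceedance N K e = (\<Union>L. {n. vol d N * e < (\<Sum>k\<in>{K..<L}. real (n k))})"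
  by (auto simp: exceedance_def)

lemma partial_exceedance_sets:
  "{n. vol d N * e < (\<Sum>k\<in>{K..<L}. real (n k))} \<in> sets (cycle_counts d \<beta> \<alpha> N)"
proof -
  note [measurable] = measurable_component_cycle_counts[of _ d \<beta> \<alpha> N]
  have "{n \<in> space (cycle_counts d \<beta> \<alpha> N). vol d N * e < (\<Sum>k\<in>{K..<L}. real (n k))}
      \<in> sets (cycle_counts d \<beta> \<alpha> N)"
    by measurable
  then show ?thesis by (simp add: space_cycle_counts)
qed

lemma exceedance_sets: "exceedance N K e \<in> sets (cycle_counts d \<beta> \<alpha> N)"
  unfolding exceedance_eq_Union by (intro sets.countable_UN) (auto intro: partial_exceedance_sets)

text \<open>Chernoff's bound.  It is proved for finite windows, uniformly in their length, and passes to the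
  increasing union of the windows.  This estimate replaces exponential tightness: for small
  \<open>q_tail K\<close> the parameter \<open>l\<close> can be taken large, making the rate \<open>l * e\<close> arbitrarily big.\<close>

lemma emeasure_exceedance_le:
  assumes N: "1 \<le> N" and l: "0 \<le> l"
  shows "emeasure (cycle_counts d \<beta> \<alpha> N) (exceedance N K e)
    \<le> ennreal (exp (vol d N * (q_tail K * exp l - l * e)))"
proof -
  let ?M = "cycle_counts d \<beta> \<alpha> N" and ?V = "vol d N"
  let ?A = "\<lambda>L. {n. ?V * e < (\<Sum>k\<in>{K..<L}. real (n k))}"
  note [measurable] = measurable_component_cycle_counts[of _ d \<beta> \<alpha> N]
  have V: "0 < ?V" using N by (rule vol_pos)
  have bound: "emeasure ?M (?A L) \<le> ennreal (exp (?V * (q_tail K * exp l - l * e)))" for L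
  proof -
    have "emeasure ?M (?A L) = (\<integral>\<^sup>+n. indicator (?A L) n \<partial>?M)"
      using partial_exceedance_sets by simp
    also have "\<dots> \<le> (\<integral>\<^sup>+n. ennreal (exp (- (l * ?V * e))) *
        (\<Prod>k\<in>{K..<L}. ennreal (exp (l * real (n k)))) \<partial>?M)"
    proof (rule nn_integral_mono)
      fix n
      have "1 \<le> exp (- (l * ?V * e)) * (\<Prod>k\<in>{K..<L}. exp (l * real (n k)))" if "n \<in> ?A L"
      proof -
        have "0 \<le> l * ((\<Sum>k\<in>{K..<L}. real (n k)) - ?V * e)"
          using l that by (intro mult_nonneg_nonneg) auto
        then show ?thesis
          by (simp add: algebra_simps sum_distrib_left flip: exp_sum exp_add)
      qed
      then show "indicator (?A L) n \<le> ennreal (exp (- (l * ?V * e))) *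
          (\<Prod>k\<in>{K..<L}. ennreal (exp (l * real (n k))))"
        by (auto simp: prod_ennreal prod_nonneg indicator_def simp flip: ennreal_mult)
    qed
    also have "\<dots> = ennreal (exp (- (l * ?V * e))) *
        (\<integral>\<^sup>+n. (\<Prod>k\<in>{K..<L}. ennreal (exp (l * real (n k)))) \<partial>?M)"
      by (rule nn_integral_cmult) measurable
    also have "(\<integral>\<^sup>+n. (\<Prod>k\<in>{K..<L}. ennreal (exp (l * real (n k)))) \<partial>?M) =
        (\<Prod>k\<in>{K..<L}. ennreal (exp (?V * q k * (exp l - 1))))"
      using V q_pos by (subst nn_integral_prod_cycle_counts) (simp_all add: nn_integral_exp_poisson)
    also have "\<dots> = ennreal (exp (?V * ((\<Sum>k\<in>{K..<L}. q k) * (exp l - 1))))"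
      by (simp add: prod_ennreal sum_distrib_left sum_distrib_right mult.assoc flip: exp_sum)
    also have "ennreal (exp (- (l * ?V * e))) * \<dots> =
        ennreal (exp (?V * ((\<Sum>k\<in>{K..<L}. q k) * (exp l - 1) - l * e)))"
      by (simp add: algebra_simps flip: ennreal_mult exp_add)
    also have "\<dots> \<le> ennreal (exp (?V * (q_tail K * exp l - l * e)))"
    proof -
      have "(\<Sum>k\<in>{K..<L}. q k) * (exp l - 1) \<le> q_tail K * exp l"
        using l by (intro mult_mono sum_q_le_q_tail q_tail_nonneg) auto
      then show ?thesis using V by (intro ennreal_leI) simp
    qed
    finally show ?thesis .
  qed
  have "emeasure ?M (exceedance N K e) = (SUP L. emeasure ?M (?A L))"
    unfolding exceedance_eq_Union
  proof (rule SUP_emeasure_incseq[symmetric])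
    show "range ?A \<subseteq> sets ?M" using partial_exceedance_sets by blast
    show "incseq ?A"
    proof (rule incseq_SucI, safe)
      fix L n assume "?V * e < (\<Sum>k\<in>{K..<L}. real (n k))"
      also have "\<dots> \<le> (\<Sum>k\<in>{K..<Suc L}. real (n k))" by (intro sum_mono2) auto
      finally show "?V * e < (\<Sum>k\<in>{K..<Suc L}. real (n k))" .
    qed
  qed
  also have "\<dots> \<le> ennreal (exp (?V * (q_tail K * exp l - l * e)))"
    by (intro SUP_least bound)
  finally show ?thesis .
qed

lemma not_exceedance_summable:
  assumes N: "1 \<le> N" and n: "n \<notin> exceedance N K e"
  shows "summable (\<lambda>k. real (n k) / vol d N)"
    and "(\<Sum>k. coord (rescaled_counts d N n) (k + K)) \<le> e"
proof -
  have V: "0 < vol d N" using N by (rule vol_pos)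
  have le: "(\<Sum>k<L. real (n (k + K)) / vol d N) \<le> e" for L
  proof -
    have "(\<Sum>k<L. real (n (k + K))) = (\<Sum>k\<in>{K..<K + L}. real (n k))"
      using sum.shift_bounds_nat_ivl[of "\<lambda>k. real (n k)" 0 K L]
      by (simp add: atLeast0LessThan add.commute)
    also have "\<dots> \<le> vol d N * e" using n by (auto simp: exceedance_def not_less)
    finally show ?thesis using V by (simp add: field_simps flip: sum_divide_distrib)
  qed
  have "summable (\<lambda>k. real (n (k + K)) / vol d N)"
    using V le by (intro bounded_imp_summable[where B = e])
      (auto simp: lessThan_Suc_atMost[symmetric] simp del: sum.lessThan_Suc)
  then show s: "summable (\<lambda>k. real (n k) / vol d N)"
    by (rule iffD1[OF summable_iff_shift])
  show "(\<Sum>k. coord (rescaled_counts d N n) (k + K)) \<le> e"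
    using le by (intro suminf_le_const summable_coord_shift) (simp add: coord_rescaled_counts[OF s])
qed

lemma count_le_of_not_exceedance:
  assumes "n \<notin> exceedance N 0 C"
  shows "n k \<le> nat \<lfloor>vol d N * C\<rfloor>"
proof -
  have "real (n k) \<le> (\<Sum>k\<in>{0..<Suc k}. real (n k))"
    by (intro member_le_sum) auto
  also have "\<dots> \<le> vol d N * C"
    using assms by (simp add: exceedance_def not_less del: sum.op_ivl_Suc)
  finally show ?thesis by (rule le_nat_floor)
qed

lemma H_CMF_truncate: "H_CMF a (truncate K x) = a / 2 * (\<Sum>k<K. coord x k)\<^sup>2"
  by (simp add: H_CMF_def total_truncate)

lemma H_CMF_mono:
  assumes "(\<Sum>k. coord x k) \<le> (\<Sum>k. coord y k)"
  shows "H_CMF a x \<le> H_CMF a y"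
  unfolding H_CMF_def using assms a_pos
  by (intro mult_left_mono power_mono suminf_nonneg summable_coord coord_nonneg) auto

lemma H_CMF_truncate_le: "H_CMF a (truncate K x) \<le> H_CMF a x"
  by (intro H_CMF_mono) (simp add: total_truncate sum_le_suminf summable_coord coord_nonneg)

text \<open>A vanishing coordinate costs \<open>q k\<close>, so a truncated sequence costs at most \<open>q_tail K\<close> more than
  its visible coordinates do.\<close>

lemma energy_truncate_le: "energy (truncate K x) \<le> ereal (energy_upto K (truncate K x) + q_tail K / \<beta>)"
  unfolding energy_eq_SUP
proof (rule SUP_least)
  fix L
  have "energy_upto L (truncate K x) \<le> energy_upto (K + L) (truncate K x)"
    by (rule energy_upto_mono) simp
  also have "\<dots> = energy_upto K (truncate K x) + (\<Sum>k\<in>{K..<K + L}. q k) / \<beta>"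
    using sum.atLeastLessThan_concat[of 0 K "K + L"
        "\<lambda>k. poisson_cost (q k) (coord (truncate K x) k)"]
    by (simp add: energy_upto_def coord_truncate atLeast0LessThan flip: add_divide_distrib)
  also have "\<dots> \<le> energy_upto K (truncate K x) + q_tail K / \<beta>"
    using beta_pos sum_q_le_q_tail by (intro add_left_mono divide_right_mono) auto
  finally show "ereal (energy_upto L (truncate K x))
      \<le> ereal (energy_upto K (truncate K x) + q_tail K / \<beta>)" by simp
qed

section \<open>Non-asymptotic bounds for the tilted law\<close>

text \<open>The tilted law before division by the partition function.  Working with it avoids any knowledge
  of the asymptotics of the partition function, which is the total mass and is recovered at the end.\<close>

definition weight :: "nat \<Rightarrow> l1_nonneg measure" where
  "weight N = density (nu d \<beta> \<alpha> N) (\<lambda>x. ennreal (exp (- \<beta> * vol d N * H_CMF a x)))"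

lemma emeasure_weight:
  assumes A: "A \<in> sets borel"
  shows "emeasure (weight N) A = (\<integral>\<^sup>+n. ennreal (exp (- \<beta> * vol d N * H_CMF a (rescaled_counts d N n))) *
      indicator A (rescaled_counts d N n) \<partial>cycle_counts d \<beta> \<alpha> N)"
proof -
  have "emeasure (weight N) A =
      (\<integral>\<^sup>+x. ennreal (exp (- \<beta> * vol d N * H_CMF a x)) * indicator A x \<partial>nu d \<beta> \<alpha> N)"
    unfolding weight_def using A by (intro emeasure_density) auto
  also have "\<dots> = (\<integral>\<^sup>+n. ennreal (exp (- \<beta> * vol d N * H_CMF a (rescaled_counts d N n))) *
      indicator A (rescaled_counts d N n) \<partial>cycle_counts d \<beta> \<alpha> N)"
    unfolding nu_def using A measurable_rescaled_counts
    by (intro nn_integral_distr) auto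
  finally show ?thesis .
qed

lemma exp_H_CMF_le_1: "exp (- \<beta> * vol d N * H_CMF a x) \<le> 1"
  using beta_pos H_CMF_nonneg by (simp add: vol_def)

lemma emeasure_weight_le_1: "A \<in> sets borel \<Longrightarrow> emeasure (weight N) A \<le> 1"
proof -
  interpret prob_space "cycle_counts d \<beta> \<alpha> N" by (rule prob_space_cycle_counts)
  assume A: "A \<in> sets borel"
  have "emeasure (weight N) A \<le> (\<integral>\<^sup>+n. 1 \<partial>cycle_counts d \<beta> \<alpha> N)"
    unfolding emeasure_weight[OF A] using exp_H_CMF_le_1[of N]
    by (intro nn_integral_mono) (auto simp: indicator_def simp del: mult_minus_left)
  then show ?thesis by (simp add: emeasure_space_1)
qed

lemma finite_measure_weight: "finite_measure (weight N)"
  using emeasure_weight_le_1[of UNIV N]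
  by (intro finite_measureI) (auto simp: weight_def top_unique)

text \<open>The non-asymptotic upper bound, by counting.  Off two rare events (too much mass beyond \<open>K\<close>, too
  much mass altogether) a configuration is within \<open>e\<close> of its truncation, and the truncations that
  occur form a finite set whose cardinality is polynomial in the volume.  Passing to the truncation
  does not increase the interaction \<open>H_CMF\<close>, and the probability of each pattern of the first \<open>K\<close>
  counts is controlled by its cost; hence each pattern contributes at most the exponential of minus
  the energy of the truncation, up to the cost \<open>q_tail K\<close> of its vanishing coordinates.  Since the
  truncation is close to \<open>A\<close>, its energy is at least \<open>c\<close>.\<close>

lemma measure_weight_le:
  assumes N: "1 \<le> N" and A: "A \<in> sets borel" and C: "0 \<le> C" and l: "0 \<le> l"
    and near: "\<And>x y. x \<in> A \<Longrightarrow> dist x y \<le> e \<Longrightarrow> ereal c \<le> energy y"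
  shows "measure (weight N) A \<le> exp (vol d N * (q_tail K * exp l - l * e))
    + exp (vol d N * (q_tail 0 * exp 1 - C))
    + (vol d N * C + 1) ^ K * exp (- vol d N * (\<beta> * c - q_tail K))"
proof -
  let ?M = "cycle_counts d \<beta> \<alpha> N" and ?V = "vol d N"
  let ?w = "\<lambda>x. exp (- \<beta> * ?V * H_CMF a x)"
  let ?x = "rescaled_counts d N"
  let ?E = "exceedance N K e" and ?E' = "exceedance N 0 C"
  let ?cyl = "\<lambda>m. {n. \<forall>k\<in>{..<K}. n k = m k}"
  have V: "0 < ?V" using N by (rule vol_pos)
  \<comment> \<open>the interaction of the truncated configuration with pattern \<open>m\<close>\<close>
  define h where "h m = a / 2 * (\<Sum>k<K. real (m k) / ?V)\<^sup>2" for m :: "nat \<Rightarrow> nat"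
  define box where "box = PiE {..<K} (\<lambda>_. {..nat \<lfloor>?V * C\<rfloor>})"
  \<comment> \<open>the patterns of the first \<open>K\<close> counts that occur in \<open>A\<close> off the two rare events\<close>
  define P where "P = {m \<in> box. \<exists>n. n \<notin> ?E \<and> n \<notin> ?E' \<and> ?x n \<in> A \<and> n \<in> ?cyl m}"
  have "finite box" unfolding box_def by (intro finite_PiE) auto
  then have finP: "finite P" by (simp add: P_def)
  have "card P \<le> card box" using \<open>finite box\<close> by (intro card_mono) (auto simp: P_def)
  also have "\<dots> = (nat \<lfloor>?V * C\<rfloor> + 1) ^ K" by (simp add: box_def card_PiE)
  finally have "real (card P) \<le> real (nat \<lfloor>?V * C\<rfloor> + 1) ^ K"
    by (metis of_nat_le_iff of_nat_power)
  also have "\<dots> \<le> (?V * C + 1) ^ K"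
    using V C by (intro power_mono) (auto simp: of_nat_floor)
  finally have cardP: "real (card P) \<le> (?V * C + 1) ^ K" .

  have pattern: "H_CMF a (truncate K (?x n)) = h m"
      "(\<Sum>k<K. poisson_cost (q k) (coord (?x n) k)) = (\<Sum>k<K. poisson_cost (q k) (real (m k) / ?V))"
    if "n \<notin> ?E" "n \<in> ?cyl m" for n m
    using that not_exceedance_summable(1)[OF N that(1)]
    by (simp_all add: H_CMF_truncate h_def coord_rescaled_counts)

  have cyl_le: "ennreal (exp (- \<beta> * ?V * h m)) * emeasure ?M (?cyl m)
      \<le> ennreal (exp (- ?V * (\<beta> * c - q_tail K)))" if mP: "m \<in> P" for m
  proof -
    obtain n where n: "n \<notin> ?E" "?x n \<in> A" "n \<in> ?cyl m"
      using mP unfolding P_def by blast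
    let ?y = "truncate K (?x n)"
    have "dist (?x n) ?y \<le> e"
      using dist_truncate_le not_exceedance_summable(2)[OF N n(1)] by (rule order_trans)
    then have "ereal c \<le> energy ?y" by (rule near[OF n(2)])
    also have "\<dots> \<le> ereal (energy_upto K ?y + q_tail K / \<beta>)" by (rule energy_truncate_le)
    finally have "c \<le> h m + (\<Sum>k<K. poisson_cost (q k) (real (m k) / ?V)) / \<beta> + q_tail K / \<beta>"
      using pattern[OF n(1) n(3)] by (simp add: energy_upto_def coord_truncate)
    then have "\<beta> * c - q_tail K \<le> \<beta> * h m + (\<Sum>k<K. poisson_cost (q k) (real (m k) / ?V))"
      using beta_pos by (simp add: field_simps)
    then have c: "?V * (\<beta> * c - q_tail K) \<le>
        ?V * (\<beta> * h m + (\<Sum>k<K. poisson_cost (q k) (real (m k) / ?V)))"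
      using V by (intro mult_left_mono) auto
    have "(\<Prod>k<K. pmf (poisson_pmf (?V * q k)) (m k)) \<le>
        (\<Prod>k<K. exp (- ?V * poisson_cost (q k) (real (m k) / ?V)))"
      by (intro prod_mono conjI pmf_nonneg pmf_poisson_le V q_pos)
    also have "\<dots> = exp (- ?V * (\<Sum>k<K. poisson_cost (q k) (real (m k) / ?V)))"
      by (simp add: sum_distrib_left sum_negf flip: exp_sum)
    finally have "exp (- \<beta> * ?V * h m) * (\<Prod>k<K. pmf (poisson_pmf (?V * q k)) (m k)) \<le>
        exp (- \<beta> * ?V * h m) * exp (- ?V * (\<Sum>k<K. poisson_cost (q k) (real (m k) / ?V)))"
      by (intro mult_left_mono) auto
    also have "\<dots> \<le> exp (- ?V * (\<beta> * c - q_tail K))"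
      using c by (simp add: algebra_simps flip: exp_add)
    finally show ?thesis
      by (simp add: emeasure_cylinder_cycle_counts ennreal_leI prod_nonneg flip: ennreal_mult)
  qed

  have pointwise: "ennreal (?w (?x n)) * indicator A (?x n) \<le>
      indicator ?E n + (indicator ?E' n +
      (\<Sum>m\<in>P. ennreal (exp (- \<beta> * ?V * h m)) * indicator (?cyl m) n))" for n
  proof (cases "n \<in> ?E \<or> n \<in> ?E' \<or> ?x n \<notin> A")
    case True
    have "ennreal (?w (?x n)) * indicator A (?x n) \<le> 1"
      using exp_H_CMF_le_1[of N "?x n"] by (auto simp: indicator_def simp del: mult_minus_left)
    with True show ?thesis
      by (auto simp: indicator_def intro: order_trans add_increasing add_increasing2)
  next
    case False
    define m where "m = restrict n {..<K}"
    have m: "m \<in> P" "n \<in> ?cyl m"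
      using False count_le_of_not_exceedance[of n N C]
      by (auto simp: P_def box_def m_def)
    have "?w (?x n) \<le> exp (- \<beta> * ?V * h m)"
      using H_CMF_truncate_le[of K "?x n"] pattern(1)[of n m] m False V beta_pos by simp
    then have "ennreal (?w (?x n)) * indicator A (?x n) \<le>
        ennreal (exp (- \<beta> * ?V * h m)) * indicator (?cyl m) n"
      using m False by (simp add: ennreal_leI del: mult_minus_left)
    also have "\<dots> \<le> (\<Sum>m\<in>P. ennreal (exp (- \<beta> * ?V * h m)) * indicator (?cyl m) n)"
      using m finP by (intro member_le_sum) auto
    finally show ?thesis using False by (simp add: indicator_def)
  qed

  have [measurable]: "?E \<in> sets ?M" "?E' \<in> sets ?M" by (rule exceedance_sets)+
  have [measurable]: "?cyl m \<in> sets ?M" for m by (rule cylinder_sets) simp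
  have "emeasure (weight N) A \<le> (\<integral>\<^sup>+n. indicator ?E n + (indicator ?E' n +
      (\<Sum>m\<in>P. ennreal (exp (- \<beta> * ?V * h m)) * indicator (?cyl m) n)) \<partial>?M)"
    unfolding emeasure_weight[OF A] by (intro nn_integral_mono pointwise)
  also have "\<dots> = emeasure ?M ?E + (emeasure ?M ?E' +
      (\<Sum>m\<in>P. ennreal (exp (- \<beta> * ?V * h m)) * emeasure ?M (?cyl m)))"
    by (subst nn_integral_add; (subst nn_integral_add)?; (subst nn_integral_sum)?)
      (simp_all add: nn_integral_cmult_indicator)
  also have "\<dots> \<le> ennreal (exp (?V * (q_tail K * exp l - l * e))) +
      (ennreal (exp (?V * (q_tail 0 * exp 1 - C))) +
      (\<Sum>m\<in>P. ennreal (exp (- ?V * (\<beta> * c - q_tail K)))))"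
    using emeasure_exceedance_le[OF N, of 1 0 C]
    by (intro add_mono sum_mono cyl_le emeasure_exceedance_le[OF N l]) auto
  also have "\<dots> = ennreal (exp (?V * (q_tail K * exp l - l * e)) +
      (exp (?V * (q_tail 0 * exp 1 - C)) + real (card P) * exp (- ?V * (\<beta> * c - q_tail K))))"
    by (simp add: ennreal_of_nat_eq_real_of_nat flip: ennreal_mult ennreal_plus)
  also have "\<dots> \<le> ennreal (exp (?V * (q_tail K * exp l - l * e)) +
      (exp (?V * (q_tail 0 * exp 1 - C)) + (?V * C + 1) ^ K * exp (- ?V * (\<beta> * c - q_tail K))))"
    by (intro ennreal_leI add_left_mono mult_right_mono cardP) simp
  finally have "measure (weight N) A \<le> exp (?V * (q_tail K * exp l - l * e)) +
      (exp (?V * (q_tail 0 * exp 1 - C)) + (?V * C + 1) ^ K * exp (- ?V * (\<beta> * c - q_tail K)))"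
    unfolding measure_def using V C
    by (intro enn2real_leI) (auto intro!: add_nonneg_nonneg mult_nonneg_nonneg)
  then show ?thesis by simp
qed

text \<open>The probability that all counts from \<open>K\<close> on vanish is the infinite product of \<open>exp (- V * q k)\<close>,
  so for a configuration without long cycles even the single point keeps a mass of the right
  exponential order.\<close>

lemma emeasure_singleton_cycle_counts_ge:
  assumes N: "1 \<le> N" and m: "\<And>k. K \<le> k \<Longrightarrow> m k = 0"
  shows "ennreal ((\<Prod>k<K. pmf (poisson_pmf (vol d N * q k)) (m k)) * exp (- vol d N * q_tail K))
    \<le> emeasure (cycle_counts d \<beta> \<alpha> N) {m}"
    and "{m} \<in> sets (cycle_counts d \<beta> \<alpha> N)"
proof -
  let ?M = "cycle_counts d \<beta> \<alpha> N" and ?V = "vol d N"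
  let ?cyl = "\<lambda>L. {n. \<forall>k\<in>{..<L}. n k = m k}"
  have V: "0 < ?V" using N by (rule vol_pos)
  interpret prob_space ?M by (rule prob_space_cycle_counts)
  have cyl: "?cyl L \<in> sets ?M" for L by (rule cylinder_sets) simp
  have Inter: "{m} = (\<Inter>L. ?cyl L)" by (auto simp: fun_eq_iff)
  show "{m} \<in> sets ?M"
    unfolding Inter
  proof (rule sets.countable_INT'')
    show "UNIV \<in> sets ?M" using sets.top[of ?M] by (simp only: space_cycle_counts)
  qed (simp_all add: cyl)
  have "emeasure ?M {m} = (INF L. emeasure ?M (?cyl L))"
    unfolding Inter
    by (rule INF_emeasure_decseq[symmetric]) (auto simp: cyl decseq_def)
  moreover have "ennreal ((\<Prod>k<K. pmf (poisson_pmf (?V * q k)) (m k)) * exp (- ?V * q_tail K))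
      \<le> emeasure ?M (?cyl L)" for L
  proof -
    have "(\<Prod>k<K. pmf (poisson_pmf (?V * q k)) (m k)) * exp (- ?V * q_tail K) \<le>
        (\<Prod>k<K. pmf (poisson_pmf (?V * q k)) (m k)) * exp (- ?V * (\<Sum>k\<in>{K..<K + L}. q k))"
      using V sum_q_le_q_tail by (intro mult_left_mono prod_nonneg) auto
    also have "exp (- ?V * (\<Sum>k\<in>{K..<K + L}. q k)) =
        (\<Prod>k\<in>{K..<K + L}. pmf (poisson_pmf (?V * q k)) (m k))"
      using V q_pos m by (simp add: sum_distrib_left exp_sum flip: sum_negf)
    also have "(\<Prod>k<K. pmf (poisson_pmf (?V * q k)) (m k)) * \<dots> =
        (\<Prod>k<K + L. pmf (poisson_pmf (?V * q k)) (m k))"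
      using prod.atLeastLessThan_concat[of 0 K "K + L" "\<lambda>k. pmf (poisson_pmf (?V * q k)) (m k)"]
      by (simp add: atLeast0LessThan del: pmf_poisson)
    finally have "ennreal ((\<Prod>k<K. pmf (poisson_pmf (?V * q k)) (m k)) * exp (- ?V * q_tail K))
        \<le> emeasure ?M (?cyl (K + L))"
      by (simp add: emeasure_cylinder_cycle_counts ennreal_leI)
    also have "\<dots> \<le> emeasure ?M (?cyl L)"
      by (intro emeasure_mono cyl) auto
    finally show ?thesis .
  qed
  ultimately show "ennreal ((\<Prod>k<K. pmf (poisson_pmf (?V * q k)) (m k)) * exp (- ?V * q_tail K))
      \<le> emeasure ?M {m}"
    by (simp add: INF_greatest)
qed

text \<open>The integer configuration that approximates \<open>truncate K x\<close> at scale \<open>vol d N\<close>.  Rounding down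
  keeps the total mass, and hence the interaction, below that of \<open>x\<close>.\<close>

definition lattice_point :: "nat \<Rightarrow> nat \<Rightarrow> l1_nonneg \<Rightarrow> nat \<Rightarrow> nat" where
  "lattice_point N K x k = (if k < K then nat \<lfloor>vol d N * coord x k\<rfloor> else 0)"

lemma coord_lattice_point:
  "coord (rescaled_counts d N (lattice_point N K x)) k = real (lattice_point N K x k) / vol d N"
  by (intro coord_rescaled_counts summable_finite[of "{..<K}"]) (auto simp: lattice_point_def)

lemma lattice_point_bounds:
  assumes "1 \<le> N" "k < K"
  shows "coord (rescaled_counts d N (lattice_point N K x)) k \<le> coord x k"
    and "coord x k - 1 / vol d N \<le> coord (rescaled_counts d N (lattice_point N K x)) k"
proof -
  have V: "0 < vol d N" using assms(1) by (rule vol_pos)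
  define t where "t = vol d N * coord x k"
  have t: "0 \<le> t" using V by (simp add: t_def coord_nonneg)
  have floor: "real (nat \<lfloor>t\<rfloor>) \<le> t" "t - 1 \<le> real (nat \<lfloor>t\<rfloor>)"
    using t by (simp_all add: of_nat_floor)
  have "coord (rescaled_counts d N (lattice_point N K x)) k = real (nat \<lfloor>t\<rfloor>) / vol d N"
    "coord x k = t / vol d N"
    using V assms(2) by (simp_all add: coord_lattice_point lattice_point_def t_def)
  then show "coord (rescaled_counts d N (lattice_point N K x)) k \<le> coord x k"
    "coord x k - 1 / vol d N \<le> coord (rescaled_counts d N (lattice_point N K x)) k"
    using V floor by (auto simp: divide_right_mono simp flip: diff_divide_distrib)
qed

lemma dist_lattice_point_le:
  assumes N: "1 \<le> N"
  shows "dist (rescaled_counts d N (lattice_point N K x)) (truncate K x) \<le> real K / vol d N"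
proof -
  let ?y = "rescaled_counts d N (lattice_point N K x)"
  have "dist ?y (truncate K x) \<le> (\<Sum>k<K. \<bar>coord ?y k - coord x k\<bar>)"
    using dist_le_head_tails[of ?y "truncate K x" K]
    by (simp add: coord_truncate) (simp add: coord_lattice_point lattice_point_def)
  also have "\<dots> \<le> (\<Sum>k<K. 1 / vol d N)"
  proof (rule sum_mono)
    fix k assume "k \<in> {..<K}"
    then show "\<bar>coord ?y k - coord x k\<bar> \<le> 1 / vol d N"
      using lattice_point_bounds[OF N, of k K x] by auto
  qed
  finally show ?thesis by simp
qed

lemma H_CMF_lattice_point_le:
  assumes N: "1 \<le> N"
  shows "H_CMF a (rescaled_counts d N (lattice_point N K x)) \<le> H_CMF a x"
proof (intro H_CMF_mono suminf_le summable_coord)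
  show "coord (rescaled_counts d N (lattice_point N K x)) k \<le> coord x k" for k
    using lattice_point_bounds(1)[OF N, of k K x] coord_nonneg[of x k]
    by (cases "k < K") (simp_all add: coord_lattice_point lattice_point_def)
qed

text \<open>The non-asymptotic lower bound: the mass of the single configuration \<open>lattice_point\<close> is enough.\<close>

lemma measure_weight_ge:
  assumes N: "1 \<le> N" and V: "1 \<le> vol d N" and A: "A \<in> sets borel"
    and mem: "rescaled_counts d N (lattice_point N K x) \<in> A"
  shows "exp (- \<beta> * vol d N * H_CMF a x
      + (\<Sum>k<K. log_poisson_minorant (q k) (coord x k) (vol d N)) - vol d N * q_tail K)
    \<le> measure (weight N) A"
proof -
  let ?M = "cycle_counts d \<beta> \<alpha> N" and ?V = "vol d N"
  let ?m = "lattice_point N K x"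
  let ?p = "\<Prod>k<K. pmf (poisson_pmf (?V * q k)) (?m k)"
  have m: "K \<le> k \<Longrightarrow> ?m k = 0" for k by (simp add: lattice_point_def)
  have "exp (\<Sum>k<K. log_poisson_minorant (q k) (coord x k) ?V) \<le> ?p"
    unfolding exp_sum[OF finite_lessThan]
    using log_poisson_minorant_le[OF V q_pos coord_nonneg]
    by (intro prod_mono) (simp add: lattice_point_def del: pmf_poisson)
  then have "exp (- \<beta> * ?V * H_CMF a x) *
      (exp (\<Sum>k<K. log_poisson_minorant (q k) (coord x k) ?V) * exp (- ?V * q_tail K)) \<le>
      exp (- \<beta> * ?V * H_CMF a (rescaled_counts d N ?m)) * (?p * exp (- ?V * q_tail K))"
    using V beta_pos H_CMF_lattice_point_le[OF N, of K x]
    by (intro mult_mono) (auto intro!: mult_nonneg_nonneg prod_nonneg)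
  then have "exp (- \<beta> * ?V * H_CMF a x
      + (\<Sum>k<K. log_poisson_minorant (q k) (coord x k) ?V) - ?V * q_tail K) \<le>
      exp (- \<beta> * ?V * H_CMF a (rescaled_counts d N ?m)) * (?p * exp (- ?V * q_tail K))"
    by (simp add: exp_add exp_diff exp_minus field_simps)
  then have "ennreal (exp (- \<beta> * ?V * H_CMF a x
      + (\<Sum>k<K. log_poisson_minorant (q k) (coord x k) ?V) - ?V * q_tail K)) \<le>
      ennreal (exp (- \<beta> * ?V * H_CMF a (rescaled_counts d N ?m))) * ennreal (?p * exp (- ?V * q_tail K))"
    by (subst ennreal_mult[symmetric]) (auto intro!: mult_nonneg_nonneg prod_nonneg ennreal_leI)
  also have "\<dots> \<le> ennreal (exp (- \<beta> * ?V * H_CMF a (rescaled_counts d N ?m))) * emeasure ?M {?m}"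
    by (intro mult_left_mono emeasure_singleton_cycle_counts_ge[OF N m]) auto
  also have "\<dots> = (\<integral>\<^sup>+n. ennreal (exp (- \<beta> * ?V * H_CMF a (rescaled_counts d N ?m))) * indicator {?m} n \<partial>?M)"
    by (rule nn_integral_cmult_indicator[symmetric])
      (rule emeasure_singleton_cycle_counts_ge[OF N m])
  also have "\<dots> \<le> emeasure (weight N) A"
    unfolding emeasure_weight[OF A] using mem
    by (intro nn_integral_mono) (auto simp: indicator_def)
  also have "\<dots> = ennreal (measure (weight N) A)"
    by (rule finite_measure.emeasure_eq_measure[OF finite_measure_weight])
  finally show ?thesis by (simp add: ennreal_le_iff)
qed

end

section \<open>Normalisation and the large deviation principle\<close>

lemma ext_log_div_le:
  assumes "0 < r" "0 \<le> p" "p \<le> exp t"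
  shows "ext_log p / ereal r \<le> ereal (t / r)"
proof (cases "p = 0")
  case True
  then show ?thesis using assms(1) by (simp add: ext_log_def)
next
  case False
  then have "ln p \<le> t" using assms by (metis exp_le_cancel_iff exp_ln less_le)
  then show ?thesis using False assms(1) by (simp add: ext_log_def divide_right_mono)
qed

lemma ext_log_div_ge:
  assumes "0 < r" "exp t \<le> p"
  shows "ereal (t / r) \<le> ext_log p / ereal r"
proof -
  have p: "0 < p" using assms(2) by (rule less_le_trans[OF exp_gt_zero])
  then have "t \<le> ln p" using assms(2) by (simp add: ln_ge_iff)
  then show ?thesis using p assms(1) by (simp add: ext_log_def divide_right_mono)
qed

text \<open>Normalising a sequence of finite measures.  The two bounds applied to the whole space show that the
  logarithmic total mass converges to minus the infimum of the rate function, so dividing by the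
  total mass shifts both bounds by a convergent sequence.\<close>

lemma large_deviation_principle_normalize:
  fixes P W :: "nat \<Rightarrow> 'a::topological_space measure" and J :: "'a \<Rightarrow> ereal"
  assumes r: "filterlim r at_top sequentially"
    and P: "\<And>N A. A \<in> sets borel \<Longrightarrow> measure (P N) A = measure (W N) A / measure (W N) UNIV"
    and pos: "\<And>N. 0 < measure (W N) UNIV"
    and closed: "\<And>c. closed {x. J x \<le> c}"
    and fin: "\<bar>INF x. J x\<bar> \<noteq> \<infinity>"
    and lower: "\<And>G. open G \<Longrightarrow>
      - (INF x\<in>G. J x) \<le> liminf (\<lambda>N. ext_log (measure (W N) G) / ereal (r N))"
    and upper: "\<And>F. closed F \<Longrightarrow>
      limsup (\<lambda>N. ext_log (measure (W N) F) / ereal (r N)) \<le> - (INF x\<in>F. J x)"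
  shows "large_deviation_principle P r (\<lambda>x. J x - (INF y. J y))"
proof -
  obtain j where j: "(INF y. J y) = ereal j" using fin by auto
  let ?L = "\<lambda>N. ext_log (measure (W N) UNIV) / ereal (r N)"
  have "limsup ?L \<le> ereal (- j)" "ereal (- j) \<le> liminf ?L"
    using upper[of UNIV] lower[of UNIV] by (simp_all add: j)
  then have "?L \<longlonglongrightarrow> ereal (- j)"
    using Liminf_le_Limsup[of sequentially ?L] by (intro Liminf_eq_Limsup antisym) simp_all
  then have L: "(\<lambda>N. - ?L N) \<longlonglongrightarrow> ereal j"
    using tendsto_uminus_ereal by fastforce
  have split: "eventually (\<lambda>N. ext_log (measure (P N) A) / ereal (r N) =
      - ?L N + ext_log (measure (W N) A) / ereal (r N)) sequentially" if "A \<in> sets borel" for A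
    using filterlim_at_top_dense[THEN iffD1, OF r, rule_format, of 0]
  proof eventually_elim
    case (elim N)
    have "measure (W N) UNIV \<noteq> 0" using pos[of N] by simp
    moreover have "0 < measure (W N) A" if "measure (W N) A \<noteq> 0"
      using that by (simp add: less_le)
    ultimately show ?case
      using elim pos[of N] by (auto simp: P[OF that] ext_log_def ln_div field_simps)
  qed
  have inf: "(INF x\<in>A. J x - ereal j) = (INF x\<in>A. J x) - ereal j" for A
  proof (rule antisym)
    have "(INF x\<in>A. J x - ereal j) + ereal j \<le> (INF x\<in>A. J x)"
    proof (rule INF_greatest)
      fix x assume "x \<in> A"
      then have "(INF x\<in>A. J x - ereal j) \<le> J x - ereal j" by (rule INF_lower)
      then show "(INF x\<in>A. J x - ereal j) + ereal j \<le> J x"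
        by (simp add: ereal_le_minus)
    qed
    then show "(INF x\<in>A. J x - ereal j) \<le> (INF x\<in>A. J x) - ereal j"
      by (simp add: ereal_le_minus)
    show "(INF x\<in>A. J x) - ereal j \<le> (INF x\<in>A. J x - ereal j)"
      by (intro INF_greatest ereal_minus_mono INF_lower) auto
  qed
  have neg: "- (z - ereal j) = ereal j + - z" for z
    by (cases z) auto
  show ?thesis
    unfolding large_deviation_principle_def j
  proof (intro conjI allI impI)
    show "filterlim r at_top sequentially" by (rule r)
    show "0 \<le> J x - ereal j" for x
      using INF_lower[of x UNIV J] by (simp add: j ereal_le_minus)
    have "{x. J x - ereal j \<le> c} = {x. J x \<le> c + ereal j}" for c
      by (simp add: ereal_minus_le)
    then show "closed {x. J x - ereal j \<le> c}" for c by (simp add: closed)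
  next
    fix G :: "'a set" assume G: "open G"
    have "- ((INF x\<in>G. J x) - ereal j) \<le>
        ereal j + liminf (\<lambda>N. ext_log (measure (W N) G) / ereal (r N))"
      unfolding neg by (intro add_left_mono lower G)
    also have "\<dots> = liminf (\<lambda>N. ext_log (measure (P N) G) / ereal (r N))"
      using G by (subst Liminf_eq[OF split]) (simp_all add: ereal_liminf_lim_add[OF L])
    finally show "- (INF x\<in>G. J x - ereal j) \<le> \<dots>" unfolding inf .
  next
    fix F :: "'a set" assume F: "closed F"
    have "limsup (\<lambda>N. ext_log (measure (P N) F) / ereal (r N)) =
        ereal j + limsup (\<lambda>N. ext_log (measure (W N) F) / ereal (r N))"
      using F by (subst Limsup_eq[OF split]) (simp_all add: ereal_limsup_lim_add[OF L])
    also have "\<dots> \<le> - ((INF x\<in>F. J x) - ereal j)"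
      unfolding neg by (intro add_left_mono upper F)
    finally show "limsup (\<lambda>N. ext_log (measure (P N) F) / ereal (r N)) \<le> - (INF x\<in>F. J x - ereal j)"
      unfolding inf .
  qed
qed

context cycle_mean_field
begin

lemma filterlim_vol: "filterlim (vol d) at_top sequentially"
proof (rule filterlim_at_top_mono[OF filterlim_real_sequentially])
  show "eventually (\<lambda>N. real N \<le> vol d N) sequentially"
    using eventually_ge_at_top[of 1]
  proof eventually_elim
    case (elim N)
    have "real N \<le> 2 * real N" by simp
    also have "\<dots> \<le> vol d N"
      unfolding vol_def using elim d_pos by (intro self_le_power) auto
    finally show ?case .
  qed
qed

lemma eventually_vol_gt: "eventually (\<lambda>N. c < vol d N) sequentially"
  using filterlim_vol by (simp add: filterlim_at_top_dense)

text \<open>Given a level \<open>c\<close> below the infimum, the parameters of the counting bound are fixed in the order: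
  neighbourhood size \<open>e\<close>, exponent \<open>l\<close>, mass bound \<open>C\<close>, and finally the truncation \<open>K\<close>.  The first two
  terms then decay at least at rate \<open>\<beta> * c\<close>, and the polynomial factor of the third is invisible at
  the scale of the volume.\<close>

lemma limsup_weight_le:
  assumes F: "closed F"
  shows "limsup (\<lambda>N. ext_log (measure (weight N) F) / ereal (\<beta> * vol d N)) \<le> - (INF x\<in>F. energy x)"
    (is "?L \<le> _")
proof (rule ccontr)
  assume "\<not> ?thesis"
  then have "- ?L < (INF x\<in>F. energy x)" by (metis ereal_uminus_le_reorder not_le ereal_uminus_uminus)
  then obtain c where c: "- ?L < ereal c" "ereal c < (INF x\<in>F. energy x)"
    using ereal_dense2 by blast
  obtain e where e: "0 < e" and near: "\<And>x y. x \<in> F \<Longrightarrow> dist x y \<le> e \<Longrightarrow> ereal c < energy y"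
    using energy_on_neighbourhood[OF F c(2)] by metis
  define l where "l = (\<bar>\<beta> * c\<bar> + 1) / e"
  define C where "C = q_tail 0 * exp 1 + \<bar>\<beta> * c\<bar> + 1"
  have l: "0 \<le> l" "l * e = \<bar>\<beta> * c\<bar> + 1" using e by (simp_all add: l_def)
  have C: "0 < C" using q_tail_nonneg[of 0] by (simp add: C_def add_nonneg_pos)
  have "?L \<le> ereal (- c) + ereal \<epsilon>" if \<epsilon>: "0 < \<epsilon>" for \<epsilon>
  proof -
    have "eventually (\<lambda>K. q_tail K < min (exp (- l)) (\<beta> * \<epsilon>)) sequentially"
      by (rule order_tendstoD(2)[OF tendsto_q_tail]) (use beta_pos \<epsilon> in simp)
    then obtain K where K: "q_tail K < exp (- l)" "q_tail K < \<beta> * \<epsilon>"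
      using eventually_happens'[OF sequentially_bot] by force
    have tail: "q_tail K * exp l - l * e \<le> - (\<beta> * c)"
      using K(1) l(2) by (simp add: exp_minus field_simps)
    define t where "t V = ln 3 + real K * ln (V * C + 1) - V * (\<beta> * (c - \<epsilon>))" for V
    have bound: "measure (weight N) F \<le> exp (t (vol d N))" if N: "1 \<le> N" for N
    proof -
      let ?V = "vol d N" and ?E = "exp (- vol d N * (\<beta> * (c - \<epsilon>)))"
      have V: "0 < ?V" using N by (rule vol_pos)
      have 1: "1 \<le> (?V * C + 1) ^ K" using V C by (intro one_le_power) simp
      have E: "exp (?V * s) \<le> ?E" if "s \<le> - (\<beta> * (c - \<epsilon>))" for s
        using mult_left_mono[OF that, of ?V] V by simp
      have \<beta>\<epsilon>: "0 < \<beta> * \<epsilon>" "\<beta> * (c - \<epsilon>) = \<beta> * c - \<beta> * \<epsilon>"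
        using beta_pos \<epsilon> by (simp_all add: right_diff_distrib)
      have "exp (?V * (q_tail K * exp l - l * e)) \<le> ?E"
        using tail \<beta>\<epsilon> by (intro E) linarith
      moreover have "exp (?V * (q_tail 0 * exp 1 - C)) \<le> ?E"
        using \<beta>\<epsilon> by (intro E) (unfold C_def, linarith)
      moreover have "exp (- ?V * (\<beta> * c - q_tail K)) \<le> ?E"
        using E[of "q_tail K - \<beta> * c"] K(2) \<beta>\<epsilon>(2) by (simp add: right_diff_distrib)
      then have "(?V * C + 1) ^ K * exp (- ?V * (\<beta> * c - q_tail K)) \<le> (?V * C + 1) ^ K * ?E"
        using 1 by (intro mult_left_mono) simp_all
      moreover have "measure (weight N) F \<le> exp (?V * (q_tail K * exp l - l * e))
          + exp (?V * (q_tail 0 * exp 1 - C))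
          + (?V * C + 1) ^ K * exp (- ?V * (\<beta> * c - q_tail K))"
        using near by (intro measure_weight_le[OF N borel_closed[OF F] less_imp_le[OF C] l(1)])
          (auto intro: less_imp_le)
      ultimately have "measure (weight N) F \<le> ?E + ?E + (?V * C + 1) ^ K * ?E"
        by linarith
      also have "\<dots> \<le> 3 * (?V * C + 1) ^ K * ?E"
        using mult_right_mono[OF 1, of ?E] by simp
      also have "\<dots> = exp (t ?V)"
        using V C by (simp add: t_def exp_add exp_diff exp_minus field_simps exp_of_nat_mult add_pos_pos)
      finally show ?thesis .
    qed
    have "?L \<le> limsup (\<lambda>N. ereal (t (vol d N) / (\<beta> * vol d N)))"
      by (rule Limsup_mono, rule eventually_mono[OF eventually_ge_at_top[of 1]])
        (use beta_pos bound in \<open>auto intro!: ext_log_div_le mult_pos_pos vol_pos\<close>)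
    also have "\<dots> = ereal (- c + \<epsilon>)"
    proof (rule lim_imp_Limsup)
      have "((\<lambda>V. ln (V * C + 1) / V) \<longlongrightarrow> 0) at_top" using C by real_asymp
      moreover have "((\<lambda>V. ln 3 / V :: real) \<longlongrightarrow> 0) at_top" by real_asymp
      ultimately have "((\<lambda>V. ln 3 / V / \<beta> + real K * (ln (V * C + 1) / V) / \<beta> - (c - \<epsilon>))
          \<longlongrightarrow> 0 / \<beta> + real K * 0 / \<beta> - (c - \<epsilon>)) at_top"
        using beta_pos by (intro tendsto_intros) auto
      moreover have "eventually (\<lambda>V. ln 3 / V / \<beta> + real K * (ln (V * C + 1) / V) / \<beta> - (c - \<epsilon>)
          = t V / (\<beta> * V)) at_top"
        using eventually_gt_at_top[of 0]
        by eventually_elim (use beta_pos in \<open>simp add: t_def field_simps\<close>)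
      ultimately have "((\<lambda>V. t V / (\<beta> * V)) \<longlongrightarrow> - c + \<epsilon>) at_top"
        by (simp add: tendsto_cong)
      from filterlim_compose[OF this filterlim_vol]
      show "(\<lambda>N. ereal (t (vol d N) / (\<beta> * vol d N))) \<longlonglongrightarrow> ereal (- c + \<epsilon>)"
        by simp
    qed simp
    finally show ?thesis by simp
  qed
  then have "?L \<le> ereal (- c)" by (rule ereal_le_epsilon2)
  then have "ereal c \<le> - ?L" by (metis ereal_uminus_le_reorder uminus_ereal.simps(1) ereal_uminus_uminus ereal_minus_le_minus)
  with c(1) show False by simp
qed

text \<open>For \<open>x\<close> in an open set, \<open>K\<close> is chosen so that \<open>truncate K x\<close> still lies in the set and
  \<open>q_tail K\<close> is negligible; then the lattice points approximating the truncation eventually lie in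
  the set as well.\<close>

lemma liminf_weight_ge:
  assumes G: "open G"
  shows "- (INF x\<in>G. energy x) \<le> liminf (\<lambda>N. ext_log (measure (weight N) G) / ereal (\<beta> * vol d N))"
    (is "_ \<le> ?L")
proof -
  have "- ?L \<le> energy x" if x: "x \<in> G" for x
  proof (rule ereal_le_epsilon2)
    fix \<epsilon> :: real assume \<epsilon>: "0 < \<epsilon>"
    obtain \<delta> where \<delta>: "0 < \<delta>" "ball x \<delta> \<subseteq> G" using G x openE by blast
    have "eventually (\<lambda>K. q_tail K < \<beta> * \<epsilon>) sequentially"
      by (rule order_tendstoD(2)[OF tendsto_q_tail]) (use beta_pos \<epsilon> in simp)
    moreover have "eventually (\<lambda>K. (\<Sum>k. coord x (k + K)) < \<delta>) sequentially"
      by (rule order_tendstoD(2)[OF suminf_exist_split2[OF summable_coord]]) (rule \<delta>)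
    ultimately have "eventually (\<lambda>K. q_tail K < \<beta> * \<epsilon> \<and> (\<Sum>k. coord x (k + K)) < \<delta>) sequentially"
      by (rule eventually_conj)
    then obtain K where K: "q_tail K < \<beta> * \<epsilon>" "(\<Sum>k. coord x (k + K)) < \<delta>"
      using eventually_happens'[OF sequentially_bot] by force
    have "truncate K x \<in> G"
      using \<delta>(2) K(2) dist_truncate_le[of x K] by (force simp: subset_iff)
    then obtain \<eta> where \<eta>: "0 < \<eta>" "ball (truncate K x) \<eta> \<subseteq> G" using G openE by blast
    define t where "t V = - \<beta> * V * H_CMF a x
      + (\<Sum>k<K. log_poisson_minorant (q k) (coord x k) V) - V * q_tail K" for V
    have "((\<lambda>V. - H_CMF a x + (\<Sum>k<K. log_poisson_minorant (q k) (coord x k) V / V) / \<beta> - q_tail K / \<beta>)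
        \<longlongrightarrow> - H_CMF a x + (\<Sum>k<K. - poisson_cost (q k) (coord x k)) / \<beta> - q_tail K / \<beta>) at_top"
      using beta_pos
      by (intro tendsto_intros tendsto_log_poisson_minorant q_pos coord_nonneg) auto
    moreover have "eventually (\<lambda>V. - H_CMF a x + (\<Sum>k<K. log_poisson_minorant (q k) (coord x k) V / V) / \<beta>
        - q_tail K / \<beta> = t V / (\<beta> * V)) at_top"
      using eventually_gt_at_top[of 0]
      by eventually_elim (use beta_pos in \<open>simp add: t_def field_simps flip: sum_divide_distrib\<close>)
    ultimately have "((\<lambda>V. t V / (\<beta> * V)) \<longlongrightarrow> - (energy_upto K x + q_tail K / \<beta>)) at_top"
      by (simp add: tendsto_cong energy_upto_def sum_negf)
    from filterlim_compose[OF this filterlim_vol]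
    have "(\<lambda>N. ereal (t (vol d N) / (\<beta> * vol d N))) \<longlonglongrightarrow> ereal (- (energy_upto K x + q_tail K / \<beta>))"
      by simp
    then have "ereal (- (energy_upto K x + q_tail K / \<beta>)) =
        liminf (\<lambda>N. ereal (t (vol d N) / (\<beta> * vol d N)))"
      by (intro lim_imp_Liminf[symmetric]) simp_all
    also have "\<dots> \<le> ?L"
    proof (rule Liminf_mono)
      show "eventually (\<lambda>N. ereal (t (vol d N) / (\<beta> * vol d N)) \<le>
          ext_log (measure (weight N) G) / ereal (\<beta> * vol d N)) sequentially"
        using eventually_ge_at_top[of 1] eventually_vol_gt[of "max 1 (real K / \<eta>)"]
      proof eventually_elim
        case (elim N)
        then have V: "1 \<le> vol d N" "real K / vol d N < \<eta>"
          using \<eta>(1) by (simp_all add: field_simps)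
        then have "rescaled_counts d N (lattice_point N K x) \<in> G"
          using \<eta>(2) dist_lattice_point_le[OF elim(1), of K x]
          by (force simp: subset_iff dist_commute)
        from measure_weight_ge[OF elim(1) V(1) borel_open[OF G] this]
        show ?case using beta_pos V(1) by (intro ext_log_div_ge) (simp_all add: t_def)
      qed
    qed
    finally have "- ?L \<le> ereal (energy_upto K x + q_tail K / \<beta>)"
      by (metis ereal_uminus_le_reorder uminus_ereal.simps(1))
    also have "\<dots> \<le> ereal (energy_upto K x) + ereal \<epsilon>"
      using K(1) beta_pos by (simp add: field_simps)
    also have "\<dots> \<le> energy x + ereal \<epsilon>"
      by (intro add_right_mono energy_upto_le_energy)
    finally show "- ?L \<le> energy x + ereal \<epsilon>" .
  qed
  then have "- ?L \<le> (INF x\<in>G. energy x)" by (rule INF_greatest)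
  then show ?thesis by (simp add: ereal_uminus_le_reorder)
qed

lemma Z_CMF_eq: "Z_CMF d \<beta> a \<alpha> N = measure (weight N) UNIV"
proof -
  have "ennreal (measure (weight N) UNIV) = (\<integral>\<^sup>+x. ennreal (exp (- \<beta> * vol d N * H_CMF a x)) \<partial>nu d \<beta> \<alpha> N)"
    unfolding finite_measure.emeasure_eq_measure[OF finite_measure_weight, symmetric]
    unfolding weight_def by (subst emeasure_density) auto
  then have "measure (weight N) UNIV = enn2real (\<integral>\<^sup>+x. ennreal (exp (- \<beta> * vol d N * H_CMF a x)) \<partial>nu d \<beta> \<alpha> N)"
    by (metis enn2real_ennreal measure_nonneg)
  also have "\<dots> = Z_CMF d \<beta> a \<alpha> N"
    unfolding Z_CMF_def by (rule integral_eq_nn_integral[symmetric]) auto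
  finally show ?thesis ..
qed

lemma weight_UNIV_pos: "0 < measure (weight N) UNIV"
proof (rule ccontr)
  interpret prob_space "nu d \<beta> \<alpha> N" by (rule prob_space_nu)
  assume "\<not> ?thesis"
  then have "measure (weight N) UNIV = 0"
    using measure_nonneg[of "weight N" UNIV] by linarith
  then have "emeasure (weight N) UNIV = 0"
    unfolding finite_measure.emeasure_eq_measure[OF finite_measure_weight] by simp
  then have "AE x in nu d \<beta> \<alpha> N. ennreal (exp (- \<beta> * vol d N * H_CMF a x)) = 0"
    unfolding weight_def by (subst (asm) emeasure_density) (auto simp: nn_integral_0_iff_AE)
  then show False by simp
qed

lemma measure_nu_CMF:
  assumes A: "A \<in> sets borel"
  shows "measure (nu_CMF d \<beta> a \<alpha> N) A = measure (weight N) A / measure (weight N) UNIV"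
proof -
  let ?Z = "measure (weight N) UNIV"
  have "emeasure (nu_CMF d \<beta> a \<alpha> N) A = (\<integral>\<^sup>+x. ennreal (1 / ?Z) *
      (ennreal (exp (- \<beta> * vol d N * H_CMF a x)) * indicator A x) \<partial>nu d \<beta> \<alpha> N)"
    unfolding nu_CMF_def Z_CMF_eq using A weight_UNIV_pos[of N]
    by (subst emeasure_density)
      (auto simp flip: ennreal_mult mult.assoc intro!: nn_integral_cong)
  also have "\<dots> = ennreal (1 / ?Z) * emeasure (weight N) A"
    unfolding weight_def using A by (subst nn_integral_cmult) (auto simp: emeasure_density)
  also have "\<dots> = ennreal (measure (weight N) A / ?Z)"
    unfolding finite_measure.emeasure_eq_measure[OF finite_measure_weight]
    by (subst ennreal_mult[symmetric]) simp_all
  finally show ?thesis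
    by (simp add: measure_def[of "nu_CMF d \<beta> a \<alpha> N"])
qed

end

theorem theorem2p1:
  fixes d :: nat and \<beta> a \<alpha> :: real
  assumes "1 \<le> d" and "0 < \<beta>" and "0 < a" and "\<alpha> \<le> 0"
  shows "large_deviation_principle (nu_CMF d \<beta> a \<alpha>) (\<lambda>N. \<beta> * vol d N) (I_CMF d \<beta> a \<alpha>)"
proof -
  interpret cycle_mean_field d \<beta> a \<alpha> using assms by unfold_locales
  have "filterlim (\<lambda>N. \<beta> * vol d N) at_top sequentially"
    using filterlim_vol beta_pos by (intro filterlim_tendsto_pos_mult_at_top[OF tendsto_const])
  then have "large_deviation_principle (nu_CMF d \<beta> a \<alpha>) (\<lambda>N. \<beta> * vol d N)
      (\<lambda>x. energy x - (INF y. energy y))"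
    by (rule large_deviation_principle_normalize[OF _ measure_nu_CMF weight_UNIV_pos
          closed_energy_le INF_energy_finite liminf_weight_ge limsup_weight_le])
  then show ?thesis by (simp add: I_CMF_def[abs_def] energy_def[abs_def])
qed

end
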